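(* Let $n\geq 0$. The symmetric group $S_n$, acting on the colorful $(n+1)$-cyclohedron $\mathcal{Z}^{c}_n$ by permuting the colors in $C(K)$ (and fixing $c^*$), acts by automorphisms, and the quotient $\mathcal{Z}^{c}_n/S_n$ is isomorphic (as a partially ordered set) to the face lattice of the ordinary $(n+1)$-cyclohedron $\mathcal{Z}_n$.
   Context: Let $K$ be a centrally symmetric convex $(2n+4)$-gon with center $o$; a diagonal is central if it passes through $o$. Centrally symmetric triangulations of $K$ have exactly one central diagonal and $n$ centrally symmetric pairs of non-central diagonals. A colored such triangulation assigns colors from an $n$-element set $C(K)$ to the non-central diagonals, both diagonals of a symmetric pair receiving the same color and distinct pairs distinct colors; the central diagonal is uncolored. A flip either flips the central diagonal, or flips both diagonals of a symmetric pair simultaneously preserving their color; flipping the central diagonal is labeled with an extra color $c^*$. With $C^*=C(K)\cup\{c^*\}$ and $C\subseteq C^*$, $t\sim_C t'$ means $t'$ is reachable from $t$ by flips with labels in $C$. The colorful cyclohedron $\mathcal{Z}^{c}_n$ is the poset consisting of a least element and the faces $(C,X)$, $C\subseteq C^*$, $X$ a $\sim_C$-class, of rank $|C|$, ordered by $(C,X)\le(C',X')$ iff $C\subseteq C'$ and $X\subseteq X'$. A permutation $\sigma$ of $C(K)$ acts by $(C,X)\mapsto(\sigma(C),\sigma(X))$, where $\sigma$ fixes $c^*$ and recolors each triangulation by replacing each color $c$ by $\sigma(c)$. The quotient is the poset of orbits, with $O\le O'$ iff some $F\in O$, $F'\in O'$ satisfy $F\le F'$. Face lattice of the ordinary cyclohedron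 $\mathcal{Z}_n$: its vertices are the (uncolored) centrally symmetric triangulations of $K$; for $j=0,\ldots,n+1$, its $j$-faces correspond to sets $D$ of pairwise non-crossing diagonals of $K$ that are unions of exactly $n+1-j$ "orbits", each orbit being either a single central diagonal or a centrally symmetric pair of non-central diagonals, the vertex set of the face being all centrally symmetric triangulations containing $D$; faces ordered by inclusion of vertex sets, plus an empty face of rank $-1$. *)

theory Defs
  imports "HOL-Analysis.Analysis" "HOL-Algebra.Group_Action"
begin

section \<open>Centrally symmetric polygons and their triangulations\<close>

type_synonym point = "real ^ 2"

definition vertices :: "point set \<Rightarrow> point set" where
  "vertices K = {v. v extreme_point_of K}"

definition convex_polygon :: "nat \<Rightarrow> point set \<Rightarrow> bool" where
  "convex_polygon m K \<longleftrightarrow> polytope K \<and> aff_dim K = 2 \<and> card (vertices K) = m"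

definition reflect :: "point \<Rightarrow> point \<Rightarrow> point" where
  "reflect z x = 2 *\<^sub>R z - x"

definition centrally_symmetric :: "point \<Rightarrow> point set \<Rightarrow> bool" where
  "centrally_symmetric z K \<longleftrightarrow> reflect z ` K = K"

text \<open>A diagonal is represented by the segment itself, as a set of points.\<close>

definition diagonals :: "point set \<Rightarrow> point set set" where
  "diagonals K = {closed_segment u v | u v.
     u \<in> vertices K \<and> v \<in> vertices K \<and> u \<noteq> v \<and> \<not> (closed_segment u v) edge_of K}"

definition central :: "point \<Rightarrow> point set \<Rightarrow> bool" where
  "central z d \<longleftrightarrow> z \<in> d"

text \<open>Diagonals that merely share an endpoint do not cross.\<close>

definition crossing :: "point set \<Rightarrow> point set \<Rightarrow> bool" where
  "crossing d e \<longleftrightarrow> d \<noteq> e \<and> rel_interior d \<inter> rel_interior e \<noteq> {}"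

definition noncrossing :: "point set set \<Rightarrow> bool" where
  "noncrossing D \<longleftrightarrow> (\<forall>d\<in>D. \<forall>e\<in>D. \<not> crossing d e)"

text \<open>A triangulation without additional vertices is identified with the set of its
  diagonals, that is, with a maximal set of pairwise non-crossing diagonals.\<close>

definition triangulation :: "point set \<Rightarrow> point set set \<Rightarrow> bool" where
  "triangulation K T \<longleftrightarrow> T \<subseteq> diagonals K \<and> noncrossing T \<and>
     (\<forall>d\<in>diagonals K. noncrossing (insert d T) \<longrightarrow> d \<in> T)"

text \<open>The pair of a diagonal and its mirror image; a singleton for a central diagonal.\<close>

definition sym_orbit :: "point \<Rightarrow> point set \<Rightarrow> point set set" where
  "sym_orbit z d = {d, reflect z ` d}"

definition cs_triangulations :: "point set \<Rightarrow> point \<Rightarrow> point set set set" where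
  "cs_triangulations K z = {T. triangulation K T \<and> (\<forall>d\<in>T. reflect z ` d \<in> T)}"

section \<open>Colored triangulations and flips\<close>

text \<open>A colored triangulation is a pair \<open>(T, \<kappa>)\<close>, where \<open>\<kappa>\<close> is a partial map whose domain
  consists of exactly the non-central diagonals in \<open>T\<close>. The label of the flip of a diagonal
  \<open>d \<in> T\<close> is then \<open>\<kappa> d\<close>: the value \<open>None\<close> serves as the extra color \<open>c\<^sup>*\<close>, and
  \<open>Some c\<close> is the color \<open>c\<close>.\<close>

type_synonym 'c colored = "point set set \<times> (point set \<Rightarrow> 'c option)"

definition colored_triangulations :: "point set \<Rightarrow> point \<Rightarrow> 'c set \<Rightarrow> 'c colored set" where
  "colored_triangulations K z CK = {(T, \<kappa>).
     T \<in> cs_triangulations K z \<and>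
     dom \<kappa> = {d \<in> T. \<not> central z d} \<and> ran \<kappa> \<subseteq> CK \<and>
     (\<forall>d\<in>dom \<kappa>. \<forall>e\<in>dom \<kappa>. \<kappa> d = \<kappa> e \<longleftrightarrow> sym_orbit z d = sym_orbit z e)}"

text \<open>The diagonal \<open>d\<close> of the triangulation \<open>T\<close> is replaced by \<open>e\<close>, the other diagonal of the
  quadrilateral left after the removal of \<open>d\<close>.\<close>

definition flips_to :: "point set \<Rightarrow> point set set \<Rightarrow> point set \<Rightarrow> point set \<Rightarrow> bool" where
  "flips_to K T d e \<longleftrightarrow> triangulation K T \<and> d \<in> T \<and> e \<noteq> d \<and> triangulation K (insert e (T - {d}))"

text \<open>Mirror-image diagonals are flipped simultaneously. The color \<open>\<kappa> d\<close> is passed on to \<open>e\<close>;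
  when both triangulations are properly colored, this determines the second coloring.\<close>

definition colored_flip ::
    "point set \<Rightarrow> point \<Rightarrow> 'c option \<Rightarrow> 'c colored \<Rightarrow> 'c colored \<Rightarrow> bool" where
  "colored_flip K z l t t' \<longleftrightarrow> (\<exists>d e.
     flips_to K (fst t) d e \<and> snd t d = l \<and>
     fst t' = (fst t - sym_orbit z d) \<union> sym_orbit z e \<and>
     snd t' e = l \<and> (\<forall>x \<in> fst t - sym_orbit z d. snd t' x = snd t x))"

definition extended_colors :: "'c set \<Rightarrow> 'c option set" where
  "extended_colors CK = insert None (Some ` CK)"

definition flip_equiv ::
    "point set \<Rightarrow> point \<Rightarrow> 'c set \<Rightarrow> 'c option set \<Rightarrow> ('c colored \<times> 'c colored) set" where
  "flip_equiv K z CK C =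
     (let S = colored_triangulations K z CK in
      {(t, t') \<in> S \<times> S. \<exists>l\<in>C. colored_flip K z l t t'}\<^sup>* \<inter> S \<times> S)"

section \<open>The colorful cyclohedron\<close>

datatype 'c cface = Least | Face "'c option set" "'c colored set"

definition colorful_cyclohedron :: "point set \<Rightarrow> point \<Rightarrow> 'c set \<Rightarrow> 'c cface set" where
  "colorful_cyclohedron K z CK = insert Least
     {Face C X | C X. C \<subseteq> extended_colors CK \<and>
        X \<in> colored_triangulations K z CK // flip_equiv K z CK C}"

fun cface_le :: "'c cface \<Rightarrow> 'c cface \<Rightarrow> bool" where
  "cface_le Least F \<longleftrightarrow> True"
| "cface_le (Face C X) Least \<longleftrightarrow> False"
| "cface_le (Face C X) (Face C' X') \<longleftrightarrow> C \<subseteq> C' \<and> X \<subseteq> X'"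

definition recolor :: "('c \<Rightarrow> 'c) \<Rightarrow> 'c colored \<Rightarrow> 'c colored" where
  "recolor \<sigma> t = (fst t, map_option \<sigma> \<circ> snd t)"

fun permute_face :: "('c \<Rightarrow> 'c) \<Rightarrow> 'c cface \<Rightarrow> 'c cface" where
  "permute_face \<sigma> Least = Least"
| "permute_face \<sigma> (Face C X) = Face (map_option \<sigma> ` C) (recolor \<sigma> ` X)"

text \<open>The group is \<open>BijGroup CK\<close>, the symmetric group on the set of colors. As its elements and
  those of \<open>BijGroup\<close> of the poset are extensional functions, the action is restricted to
  the poset.\<close>

definition color_action ::
    "point set \<Rightarrow> point \<Rightarrow> 'c set \<Rightarrow> ('c \<Rightarrow> 'c) \<Rightarrow> 'c cface \<Rightarrow> 'c cface" where
  "color_action K z CK \<sigma> = restrict (permute_face \<sigma>) (colorful_cyclohedron K z CK)"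

definition quotient_poset :: "point set \<Rightarrow> point \<Rightarrow> 'c set \<Rightarrow> 'c cface set set" where
  "quotient_poset K z CK =
     orbits (BijGroup CK) (colorful_cyclohedron K z CK) (color_action K z CK)"

definition quotient_le :: "'c cface set \<Rightarrow> 'c cface set \<Rightarrow> bool" where
  "quotient_le P P' \<longleftrightarrow> (\<exists>F\<in>P. \<exists>F'\<in>P'. cface_le F F')"

section \<open>The ordinary cyclohedron\<close>

definition cyclohedron_faces :: "nat \<Rightarrow> point set \<Rightarrow> point \<Rightarrow> nat \<Rightarrow> point set set set set" where
  "cyclohedron_faces n K z j =
     {{T \<in> cs_triangulations K z. \<Union>\<O> \<subseteq> T} | \<O>.
        \<O> \<subseteq> sym_orbit z ` diagonals K \<and> card \<O> = n + 1 - j \<and> noncrossing (\<Union>\<O>)}"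

text \<open>Faces are identified with their vertex sets; the empty face is the empty set.\<close>

definition cyclohedron_face_lattice :: "nat \<Rightarrow> point set \<Rightarrow> point \<Rightarrow> point set set set set" where
  "cyclohedron_face_lattice n K z = insert {} (\<Union>j\<in>{0..n+1}. cyclohedron_faces n K z j)"

definition poset_isomorphic ::
    "'a set \<Rightarrow> ('a \<Rightarrow> 'a \<Rightarrow> bool) \<Rightarrow> 'b set \<Rightarrow> ('b \<Rightarrow> 'b \<Rightarrow> bool) \<Rightarrow> bool" where
  "poset_isomorphic A leA B leB \<longleftrightarrow>
     (\<exists>f. bij_betw f A B \<and> (\<forall>x\<in>A. \<forall>y\<in>A. leA x y \<longleftrightarrow> leB (f x) (f y)))"

end

theory Submission
  imports Defs
begin

text \<open>
  Forgetting the colours sends a face \<open>(C, X)\<close> to the set of all centrally symmetric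
  triangulations containing \<open>D\<close>, the diagonals with labels outside \<open>C\<close> in any member
  of \<open>X\<close>: flips with labels in \<open>C\<close> preserve \<open>D\<close> and its colours, and they
  connect all centrally symmetric triangulations containing \<open>D\<close>. Such a star determines \<open>D\<close>,
  since every other diagonal can be flipped away. As each triangulation has exactly \<open>n\<close>
  non-central orbits, two colourings of the same triangulation differ by a permutation of the
  colours, so the star determines the face up to this action.

  For connectedness, let a diagonal \<open>p\<close> of the target be missing. Flipping the first diagonal
  met on the way along \<open>p\<close> from one of its ends, together with the mirror image of that
  diagonal, lowers the number of crossings with \<open>p\<close>, provided that the central diagonals of
  both triangulations already agree or \<open>p\<close> is the central one. Hence the central diagonal
  of the target is produced first.

  All geometric input is contained in the counterclockwise relation on the vertices, a cyclic order.
\<close>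

section \<open>The cyclic order of the vertices\<close>

text \<open>The proviso on the central diagonals comes from the mirror images. The diagonal
  \<open>e\<close> created by a flip of \<open>d\<close> ends in an end of \<open>p\<close>, so it
  does not cross \<open>p\<close>; but its mirror image is inserted as well, and that one might. If
  \<open>p\<close> is central, the mirror image ends in the other end of \<open>p\<close>. If both
  triangulations contain the same central diagonal \<open>c\<close>, then \<open>d\<close> and
  \<open>e\<close> lie on one side of \<open>c\<close> and the mirror image of \<open>e\<close> on
  the other, so that \<open>p\<close>, which crosses \<open>d\<close>, could cross this image only
  by crossing \<open>c\<close>, a member of the target like \<open>p\<close> itself. The same
  separation shows that the simultaneous flip of a non-central pair yields a triangulation again.
  Therefore the existence of a central diagonal in each symmetric triangulation has to be proved
  early. The count of the orbits matters because there are equally many labels: each label,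
  \<open>None\<close> included, then occurs on exactly one orbit of a colored triangulation. Hence
  the set \<open>C\<close> and the fixed diagonals determine each other.\<close>

definition area :: "point \<Rightarrow> point \<Rightarrow> point \<Rightarrow> real" where
  "area a b c = (b$1 - a$1) * (c$2 - a$2) - (b$2 - a$2) * (c$1 - a$1)"

lemma area_rotate: "area a b c = area b c a"
  and area_swap: "area b a c = - area a b c"
  and area_self [simp]: "area a b a = 0" "area a b b = 0" "area a a b = 0"
  by (simp_all add: area_def algebra_simps)

text \<open>\<open>area\<close> is twice the signed area of a triangle. For fixed \<open>a\<close>
  and \<open>b\<close> it is an affine function of the third point, whose sign tells the sides of
  the line through \<open>a\<close> and \<open>b\<close> apart.\<close>

lemma area_combination:
  "area a b ((1 - t) *\<^sub>R x + t *\<^sub>R y) = (1 - t) * area a b x + t * area a b y"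
  by (simp add: area_def algebra_simps)

text \<open>Normal vector and offset of the line through \<open>a\<close> and \<open>b\<close>, as
  needed for supporting half-planes.\<close>

lemma area_inner:
  "area a b x = (\<chi> i. if i = 1 then - (b$2 - a$2) else b$1 - a$1) \<bullet> x
     - ((b$1 - a$1) * a$2 - (b$2 - a$2) * a$1)"
  by (simp add: area_def inner_vec_def sum_2 algebra_simps)

text \<open>Cramer's rule: four points of the plane are affinely dependent, and the coefficient of
  each is, up to sign, the area of the triangle formed by the other three.\<close>

lemma area_barycentric:
  "area b c d *\<^sub>R a - area a c d *\<^sub>R b + area a b d *\<^sub>R c - area a b c *\<^sub>R d = 0"
  "area b c d - area a c d + area a b d - area a b c = 0"
  by (simp_all add: area_def vec_eq_iff forall_2 algebra_simps)

lemma area_reflect: "area (reflect z a) (reflect z b) (reflect z c) = area a b c"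
  by (simp add: area_def reflect_def algebra_simps)

lemma reflect_reflect [simp]: "reflect z (reflect z a) = a"
  by (simp add: reflect_def)

lemma reflect_image_reflect_image [simp]: "reflect z ` reflect z ` A = A"
  by (simp add: image_comp)

lemma inj_reflect: "inj (reflect z)"
  by (metis injI reflect_reflect)

lemma reflect_affine:
  "reflect z ((1 - t) *\<^sub>R x + t *\<^sub>R y) = (1 - t) *\<^sub>R reflect z x + t *\<^sub>R reflect z y"
proof -
  have "2 *\<^sub>R z = (1 - t) *\<^sub>R (2 *\<^sub>R z) + t *\<^sub>R (2 *\<^sub>R z)"
    by (metis add.commute diff_add_cancel scaleR_left_distrib scaleR_one)
  then show ?thesis
    by (simp add: reflect_def scaleR_right_diff_distrib)
qed

lemma reflect_closed_segment:
  "reflect z ` closed_segment a b = closed_segment (reflect z a) (reflect z b)"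
proof -
  have "reflect z ` closed_segment a b =
      (\<lambda>t. reflect z ((1 - t) *\<^sub>R a + t *\<^sub>R b)) ` {0..1}"
    unfolding closed_segment_image_interval by (simp add: image_comp comp_def)
  then show ?thesis
    unfolding closed_segment_image_interval reflect_affine .
qed

lemma reflect_open_segment:
  "reflect z ` open_segment a b = open_segment (reflect z a) (reflect z b)"
  unfolding open_segment_def by (simp add: image_set_diff inj_reflect reflect_closed_segment)

lemma mem_reflect_image_iff: "reflect z x \<in> reflect z ` A \<longleftrightarrow> x \<in> A"
  by (simp add: inj_image_mem_iff inj_reflect)

lemma centre_in_open_segment:
  assumes "a \<noteq> z"
  shows "z \<in> open_segment a (reflect z a)"
proof -
  have "z = (1 - 1/2) *\<^sub>R a + (1/2) *\<^sub>R reflect z a"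
    by (simp add: reflect_def algebra_simps)
  moreover have "a \<noteq> reflect z a"
  proof
    assume "a = reflect z a"
    then have "2 *\<^sub>R a = 2 *\<^sub>R z" by (simp add: reflect_def scaleR_2 algebra_simps)
    then show False using assms by simp
  qed
  ultimately show ?thesis
    unfolding in_segment(2) by (intro conjI exI[of _ "1/2"]) auto
qed

text \<open>Three counterclockwise triangles around \<open>a\<close> would make \<open>a\<close> a convex combination.\<close>

lemma extreme_point_area:
  assumes "a extreme_point_of K" "b \<in> K - {a}" "c \<in> K - {a}" "d \<in> K - {a}" "convex K"
    and "area a b c \<ge> 0" "area a c d \<ge> 0" "area a d b \<ge> 0"
  shows "area a b c = 0 \<and> area a c d = 0 \<and> area a d b = 0"
proof (rule ccontr)
  assume neg: "\<not> ?thesis"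
  define s where "s = area a b c + area a c d + area a d b"
  have s: "s > 0" using assms neg unfolding s_def by argo
  \<comment> \<open>The signed areas at \<open>a\<close> add up to that of the triangle
    \<open>b c d\<close>; divided by this sum they are the weights of \<open>a\<close>.\<close>
  have "area b c d = s"
    unfolding s_def by (simp add: area_def algebra_simps)
  moreover have "area a b d = - area a d b" by (simp add: area_def algebra_simps)
  ultimately have e: "s *\<^sub>R a = area a c d *\<^sub>R b + area a d b *\<^sub>R c + area a b c *\<^sub>R d"
    using area_barycentric(1)[of b c d a] by (simp add: algebra_simps)
  have "a = (1/s) *\<^sub>R (s *\<^sub>R a)" using s by simp
  also have "\<dots> = (area a c d / s) *\<^sub>R b + (area a d b / s) *\<^sub>R c + (area a b c / s) *\<^sub>R d"
    unfolding e by (simp add: scaleR_right_distrib)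
  finally have a: "a = (area a c d / s) *\<^sub>R b + (area a d b / s) *\<^sub>R c + (area a b c / s) *\<^sub>R d" .
  have "area a c d / s + area a d b / s + area a b c / s = 1"
    using s by (simp add: s_def add_divide_distrib[symmetric] add_ac)
  then have "a \<in> convex hull {b, c, d}"
    unfolding convex_hull_3 using a s assms(6-8) by (auto intro!: exI)
  moreover have "convex (K - {a})"
    using assms(1,5) extreme_point_of_stillconvex by blast
  ultimately show False
    using hull_minimal[of "{b,c,d}" "K - {a}" convex] assms(2-4) by blast
qed

section \<open>The axioms of a cyclic order for the vertices\<close>

locale symmetric_polygon =
  fixes n :: nat and K :: "point set" and z :: point
  assumes polygon: "convex_polygon (2 * n + 4) K"
    and symmetric: "centrally_symmetric z K"
begin

definition V where "V = vertices K"

definition mirror where "mirror = reflect z"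

text \<open>Membership in \<open>V\<close> is built in, so that rotation, asymmetry and transitivity
  hold without side conditions.\<close>

definition L :: "point \<Rightarrow> point \<Rightarrow> point \<Rightarrow> bool" where
  "L a b c \<longleftrightarrow> a \<in> V \<and> b \<in> V \<and> c \<in> V \<and> area a b c > 0"

text \<open>This is the open arc leading counterclockwise from \<open>b\<close> to \<open>a\<close>,
  which lies to the left of the directed line from \<open>a\<close> to \<open>b\<close>.\<close>

definition side where "side a b = {x. L a b x}"

lemma polytope: "polytope K"
  using polygon by (simp add: convex_polygon_def)

lemma convex: "convex K"
  by (simp add: polytope polytope_imp_convex)

lemma V_iff: "a \<in> V \<longleftrightarrow> a extreme_point_of K"
  by (simp add: V_def vertices_def)

lemma V_subset: "V \<subseteq> K"
  by (auto simp: V_iff extreme_point_of_def)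

lemma card_V: "card V = 2 * n + 4"
  using polygon by (simp add: convex_polygon_def V_def)

lemma finite_V: "finite V"
  using card_V by (metis add_eq_0_iff_both_eq_0 card.infinite zero_neq_numeral)

lemma K_hull: "K = convex hull V"
  using Krein_Milman_Minkowski[OF polytope_imp_compact[OF polytope] convex]
  by (simp add: V_def vertices_def)

lemma L_rotate: "L a b c \<Longrightarrow> L b c a"
  unfolding L_def using area_rotate[of a b c] by simp

lemma L_asym: "L a b c \<Longrightarrow> \<not> L b a c"
  unfolding L_def using area_swap[of a b c] by simp

text \<open>If the conclusion failed, the triangles \<open>a b c\<close>, \<open>a c d\<close> and
  \<open>a d b\<close> around the extreme point \<open>a\<close> would all have nonnegative area,
  the first two positive area.\<close>

lemma L_trans:
  assumes "L a b c" "L a c d"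
  shows "L a b d"
proof (rule ccontr)
  assume "\<not> L a b d"
  with assms have "area a b c > 0" "area a c d > 0" "area a d b \<ge> 0"
    and V: "a \<in> V" "b \<in> V" "c \<in> V" "d \<in> V"
    unfolding L_def by (auto simp: area_def algebra_simps)
  moreover from this have "b \<noteq> a" "c \<noteq> a" "d \<noteq> a" by auto
  ultimately show False
    using extreme_point_area[of a K b c d] V_subset convex V_iff by fastforce
qed

text \<open>Area zero would make the three vertices collinear, so one of them would lie between the
  other two, which an extreme point cannot.\<close>

lemma L_total:
  assumes "a \<in> V" "b \<in> V" "c \<in> V" "a \<noteq> b" "a \<noteq> c" "b \<noteq> c"
  shows "L a b c \<or> L b a c"
proof (rule ccontr)
  assume "\<not> ?thesis"
  then have "area a b c = 0"
    unfolding L_def using assms area_swap[of a b c] by auto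
  define u where "u = b - a"
  have "u \<noteq> 0" using assms by (simp add: u_def)
  then have nz: "u \<bullet> u \<noteq> 0" by simp
  \<comment> \<open>The coefficient of the orthogonal projection of \<open>c - a\<close> to
    \<open>u\<close>, which is \<open>c - a\<close> itself because the two are parallel.\<close>
  define t where "t = ((c - a) \<bullet> u) / (u \<bullet> u)"
  have par: "u$1 * (c - a)$2 = u$2 * (c - a)$1"
    using \<open>area a b c = 0\<close> by (simp add: area_def u_def)
  have "(u \<bullet> u) * (c - a)$1 = ((c - a) \<bullet> u) * u$1" "(u \<bullet> u) * (c - a)$2 = ((c - a) \<bullet> u) * u$2"
    using par unfolding inner_vec_def sum_2 inner_real_def by algebra+
  then have "c - a = t *\<^sub>R u"
    unfolding t_def using nz by (simp add: vec_eq_iff forall_2 field_simps)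
  then have "c = a + t *\<^sub>R u" by (metis add.commute diff_add_cancel)
  moreover have "a = a + 0 *\<^sub>R u" "b = a + 1 *\<^sub>R u" by (simp_all add: u_def)
  ultimately have "collinear {a, b, c}"
    unfolding collinear_alt by blast
  then have "c \<in> closed_segment a b \<or> a \<in> closed_segment b c \<or> b \<in> closed_segment c a"
    unfolding collinear_between_cases between_mem_segment by blast
  then show False
    using assms V_subset unfolding V_iff extreme_point_of_def open_segment_def by blast
qed

lemma area_nonzero:
  "\<lbrakk>a \<in> V; b \<in> V; c \<in> V; a \<noteq> b; a \<noteq> c; b \<noteq> c\<rbrakk> \<Longrightarrow> area a b c \<noteq> 0"
  using L_total[of a b c] area_swap[of a b c] unfolding L_def by linarith

lemma L_V: "L a b c \<Longrightarrow> a \<in> V \<and> b \<in> V \<and> c \<in> V"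
  by (simp add: L_def)

lemma L_distinct: "L a b c \<Longrightarrow> a \<noteq> b \<and> a \<noteq> c \<and> b \<noteq> c"
  by (auto simp: L_def)

section \<open>The half turn about the centre\<close>

lemma mirror_image_V: "mirror ` V = V"
proof -
  have "mirror x \<in> V" if "x \<in> V" for x
  proof -
    have K: "reflect z ` K = K" using symmetric by (simp add: centrally_symmetric_def)
    show ?thesis
      unfolding V_iff extreme_point_of_def
    proof (intro conjI ballI notI)
      show "mirror x \<in> K" using that V_subset K by (auto simp: mirror_def)
      fix a b assume ab: "a \<in> K" "b \<in> K" "mirror x \<in> open_segment a b"
      then have "x \<in> open_segment (reflect z a) (reflect z b)"
        by (metis mem_reflect_image_iff mirror_def reflect_open_segment reflect_reflect)
      moreover have "reflect z a \<in> K" "reflect z b \<in> K" using ab K by auto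
      ultimately show False using that by (auto simp: V_iff extreme_point_of_def)
    qed
  qed
  then show ?thesis
    by (metis image_subsetI mirror_def reflect_image_reflect_image subset_antisym image_mono)
qed

lemma mirror_V [simp]: "mirror x \<in> V \<longleftrightarrow> x \<in> V"
  by (metis mem_reflect_image_iff mirror_def mirror_image_V)

lemma mirror_mirror [simp]: "mirror (mirror x) = x"
  by (simp add: mirror_def)

lemma L_mirror [simp]: "L (mirror a) (mirror b) (mirror c) \<longleftrightarrow> L a b c"
  by (simp add: L_def) (simp add: mirror_def area_reflect)

text \<open>The centre is the midpoint of any other vertex and its mirror image, so it is not
  extreme.\<close>

lemma centre_not_V: "z \<notin> V"
proof
  assume z: "z \<in> V"
  have "\<not> V \<subseteq> {z}"
    using card_V card_mono[of "{z}" V] by auto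
  then obtain v where "v \<in> V" "v \<noteq> z" by auto
  then show False
    using z centre_in_open_segment[of v z] mirror_V[of v] V_subset
    unfolding mirror_def by (auto simp: V_iff extreme_point_of_def)
qed

lemma mirror_neq: "a \<in> V \<Longrightarrow> mirror a \<noteq> a"
  using centre_in_open_segment[of a z] centre_not_V unfolding mirror_def
  by (metis empty_iff open_segment_idem)

section \<open>Central diagonals, crossings and edges in terms of the cyclic order\<close>

text \<open>If the centre is on the segment, then \<open>mirror a\<close> is on the line through
  \<open>a\<close> and \<open>b\<close>, and no three vertices are collinear.\<close>

lemma central_iff:
  assumes "a \<in> V" "b \<in> V" "a \<noteq> b"
  shows "central z (closed_segment a b) \<longleftrightarrow> b = mirror a"
proof
  assume "b = mirror a"
  then show "central z (closed_segment a b)"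
    using centre_in_open_segment[of a z] assms centre_not_V
    by (auto simp: central_def mirror_def open_segment_def)
next
  assume "central z (closed_segment a b)"
  then obtain t where t: "z = (1 - t) *\<^sub>R a + t *\<^sub>R b"
    unfolding central_def in_segment by auto
  have "mirror a = 2 *\<^sub>R z - a" by (simp add: mirror_def reflect_def)
  also have "\<dots> = (1 - 2 * t) *\<^sub>R a + (2 * t) *\<^sub>R b"
    by (subst t) (simp add: algebra_simps scaleR_2)
  finally have "mirror a = (1 - 2 * t) *\<^sub>R a + (2 * t) *\<^sub>R b" .
  then have "area a b (mirror a) = 0"
    by (simp only: area_combination) simp
  then have "\<not> L a b (mirror a)" "\<not> L b a (mirror a)"
    by (simp_all add: L_def area_swap[of a b])
  then show "b = mirror a"
    using L_total[of a b "mirror a"] assms mirror_neq[of a] by auto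
qed

text \<open>At a common inner point the affine function \<open>area a b\<close> vanishes, so its
  values at \<open>c\<close> and \<open>d\<close> have opposite signs or are both zero; in the
  latter case the two segments would coincide. Conversely, the areas give the weights of the
  intersection point on both segments.\<close>

lemma crossing_iff:
  assumes "a \<in> V" "b \<in> V" "a \<noteq> b" "c \<in> V" "d \<in> V" "c \<noteq> d"
  shows "crossing (closed_segment a b) (closed_segment c d) \<longleftrightarrow>
    L a b c \<and> L b a d \<or> L a b d \<and> L b a c"
proof
  assume "crossing (closed_segment a b) (closed_segment c d)"
  then obtain p where p: "p \<in> open_segment a b" "p \<in> open_segment c d"
    and ne: "{a, b} \<noteq> {c, d}"
    using assms by (auto simp: crossing_def rel_interior_closed_segment)
  obtain s where "p = (1 - s) *\<^sub>R a + s *\<^sub>R b"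
    using p(1) in_segment(2) by blast
  then have p0: "area a b p = 0" by (simp only: area_combination) simp
  obtain t where t: "0 < t" "t < 1" "p = (1 - t) *\<^sub>R c + t *\<^sub>R d"
    using p(2) in_segment(2) by blast
  have eq: "(1 - t) * area a b c + t * area a b d = 0"
    using p0 unfolding t(3) area_combination .
  have c: "area a b c \<noteq> 0 \<or> c = a \<or> c = b" "area a b d \<noteq> 0 \<or> d = a \<or> d = b"
    using area_nonzero[of a b c] area_nonzero[of a b d] assms by blast+
  have "area a b c \<noteq> 0 \<or> area a b d \<noteq> 0" using c ne assms(6) by auto
  then have "area a b c * area a b d < 0"
    using eq t(1,2) 
    by (smt (verit, ccfv_SIG) mult_eq_0_iff mult_neg_pos mult_pos_neg zero_less_mult_iff mult_neg_neg)
  then show "L a b c \<and> L b a d \<or> L a b d \<and> L b a c"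
    using assms unfolding L_def area_swap[of a b] mult_less_0_iff by auto
next
  have *: "crossing (closed_segment a b) (closed_segment c d)"
    if "L a b c" "L b a d" for c d
  proof -
    have "L c d b" "L d c a" using that L_rotate L_trans by blast+
    define \<alpha> \<beta> \<gamma> \<delta> where abcd: "\<alpha> = area a b c" "\<beta> = area b a d" "\<gamma> = area c d b" "\<delta> = area d c a"
    have pos: "\<alpha> > 0" "\<beta> > 0" "\<gamma> > 0" "\<delta> > 0"
      using that \<open>L c d b\<close> \<open>L d c a\<close> unfolding L_def abcd by auto
    \<comment> \<open>Both sides are twice the area of the quadrilateral, cut along one diagonal or
      the other.\<close>
    have sum: "\<alpha> + \<beta> = \<gamma> + \<delta>" unfolding abcd by (simp add: area_def algebra_simps)
    have comb: "\<beta> *\<^sub>R c + \<alpha> *\<^sub>R d = \<gamma> *\<^sub>R a + \<delta> *\<^sub>R b"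
      unfolding abcd by (simp add: area_def vec_eq_iff forall_2 algebra_simps)
    define p where "p = (1 / (\<alpha> + \<beta>)) *\<^sub>R (\<beta> *\<^sub>R c + \<alpha> *\<^sub>R d)"
    have "1 - \<alpha> / (\<alpha> + \<beta>) = \<beta> / (\<alpha> + \<beta>)" "1 - \<delta> / (\<gamma> + \<delta>) = \<gamma> / (\<gamma> + \<delta>)"
      using pos by (auto simp: field_simps)
    moreover have "p = (1 / (\<gamma> + \<delta>)) *\<^sub>R (\<gamma> *\<^sub>R a + \<delta> *\<^sub>R b)"
      unfolding p_def comb sum ..
    ultimately have "p = (1 - \<alpha> / (\<alpha> + \<beta>)) *\<^sub>R c + (\<alpha> / (\<alpha> + \<beta>)) *\<^sub>R d"
      "p = (1 - \<delta> / (\<gamma> + \<delta>)) *\<^sub>R a + (\<delta> / (\<gamma> + \<delta>)) *\<^sub>R b"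
      by (simp_all add: p_def scaleR_right_distrib)
    moreover have "0 < \<alpha> / (\<alpha> + \<beta>)" "\<alpha> / (\<alpha> + \<beta>) < 1" "0 < \<delta> / (\<gamma> + \<delta>)" "\<delta> / (\<gamma> + \<delta>) < 1"
      using pos by auto
    moreover have "c \<noteq> d" using \<open>L c d b\<close> L_distinct by auto
    ultimately have "p \<in> open_segment c d \<inter> open_segment a b"
      unfolding Int_iff in_segment(2) using \<open>a \<noteq> b\<close> by (intro conjI exI) assumption+
    moreover have "closed_segment a b \<noteq> closed_segment c d"
      using that L_distinct[OF that(1)] by (auto simp: doubleton_eq_iff)
    ultimately show ?thesis
      using assms \<open>c \<noteq> d\<close> by (auto simp: crossing_def rel_interior_closed_segment)
  qed
  assume "L a b c \<and> L b a d \<or> L a b d \<and> L b a c"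
  then show "crossing (closed_segment a b) (closed_segment c d)"
    using *[of c d] *[of d c] by (auto simp: closed_segment_commute)
qed

text \<open>If there are vertices on both sides, the segment joining them crosses
  \<open>a b\<close>, and a face that contains the crossing point contains both of its ends. If one
  side is empty, the line through \<open>a\<close> and \<open>b\<close> supports \<open>K\<close>,
  and the face on it has no extreme points besides \<open>a\<close> and \<open>b\<close>.\<close>

lemma edge_iff:
  assumes "a \<in> V" "b \<in> V" "a \<noteq> b"
  shows "closed_segment a b edge_of K \<longleftrightarrow> side a b = {} \<or> side b a = {}"
proof
  assume edge: "closed_segment a b edge_of K"
  show "side a b = {} \<or> side b a = {}"
  proof (rule ccontr)
    assume "\<not> ?thesis"
    then obtain c d where cd: "L a b c" "L b a d" by (auto simp: side_def)
    then have V: "c \<in> V" "d \<in> V" and ne: "c \<noteq> a" "c \<noteq> b" "c \<noteq> d"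
      using L_V L_distinct L_asym by metis+
    then have "crossing (closed_segment a b) (closed_segment c d)"
      using crossing_iff assms cd by blast
    then obtain p where p: "p \<in> open_segment a b" "p \<in> open_segment c d"
      using assms ne by (auto simp: crossing_def rel_interior_closed_segment)
    have "closed_segment a b face_of K" using edge by (simp add: edge_of_def)
    then have "c \<in> closed_segment a b"
      using V V_subset p unfolding face_of_def open_segment_def by blast
    moreover have "c \<notin> open_segment a b"
      using V V_subset assms by (auto simp: V_iff extreme_point_of_def)
    ultimately show False using ne by (auto simp: open_segment_def)
  qed
next
  have *: "closed_segment a b edge_of K" if "side a b = {}" "a \<in> V" "b \<in> V" "a \<noteq> b" for a b
  proof -
    define u :: point where "u = (\<chi> i. if i = 1 then - (b$2 - a$2) else b$1 - a$1)"
    define h where "h = (b$1 - a$1) * a$2 - (b$2 - a$2) * a$1"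
    have area: "area a b x = u \<bullet> x - h" for x
      unfolding u_def h_def by (rule area_inner)
    have "V \<subseteq> {x. u \<bullet> x \<le> h}"
      using that area unfolding side_def L_def by force
    then have "convex hull V \<subseteq> {x. u \<bullet> x \<le> h}"
      by (intro hull_minimal convex_halfspace_le)
    then have le: "x \<in> K \<Longrightarrow> u \<bullet> x \<le> h" for x
      using K_hull by blast
    define F where "F = K \<inter> {x. u \<bullet> x = h}"
    have F: "F face_of K"
      unfolding F_def using face_of_Int_supporting_hyperplane_le[OF convex le] by blast
    have "x = a \<or> x = b" if "x \<in> V" "x \<in> F" for x
    proof -
      have "area a b x = 0" using that(2) by (simp add: F_def area)
      then show ?thesis
        using L_total[of a b x] that \<open>a \<in> V\<close> \<open>b \<in> V\<close> \<open>a \<noteq> b\<close> unfolding L_def area_swap[of a b] by auto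
    qed
    moreover have "a \<in> F" "b \<in> F"
      using that V_subset area[of a] area[of b] by (auto simp: F_def)
    ultimately have "{x. x extreme_point_of F} = {a, b}"
      using that extreme_point_of_face[OF F] by (auto simp: V_iff)
    moreover have "compact F" "convex F"
      using F face_of_imp_compact face_of_imp_convex polytope polytope_imp_compact convex by blast+
    ultimately have "F = closed_segment a b"
      using Krein_Milman_Minkowski[of F] by (simp add: segment_convex_hull)
    moreover have "aff_dim (closed_segment a b) = 1"
      using that(4) by (simp add: segment_convex_hull aff_dim_convex_hull aff_dim_2)
    ultimately show ?thesis using F by (simp add: edge_of_def)
  qed
  assume "side a b = {} \<or> side b a = {}"
  then show "closed_segment a b edge_of K"
    using * assms by (metis closed_segment_commute)
qed

section \<open>Triangles and flips\<close>

lemma finite_L: "finite {y. L a y x}"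
  by (rule finite_subset[OF _ finite_V]) (auto simp: L_def)

lemma finite_side: "finite (side a b)"
  by (rule finite_subset[OF _ finite_V]) (auto simp: L_def side_def)

lemma card_L_mono:
  assumes "L a x y"
  shows "card {w. L a w x} < card {w. L a w y}"
proof (rule psubset_card_mono[OF finite_L])
  have "x \<notin> {w. L a w x}" using L_distinct by blast
  then show "{w. L a w x} \<subset> {w. L a w y}" using assms L_trans by blast
qed

text \<open>Seen from \<open>a\<close>, the other vertices are strictly ordered by
  \<open>L a\<close>, and the number of predecessors is a strictly increasing rank.\<close>

lemma first_exists:
  assumes "P x"
  shows "\<exists>x. P x \<and> (\<forall>y. P y \<longrightarrow> \<not> L a y x)"
proof -
  obtain m where "P m" "\<And>y. P y \<Longrightarrow> card {w. L a w m} \<le> card {w. L a w y}"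
    using ex_has_least_nat[of P x "\<lambda>x. card {w. L a w x}"] assms by blast
  then show ?thesis using card_L_mono[of a _ m] by (meson linorder_not_less)
qed

lemma last_exists:
  assumes "P x"
  shows "\<exists>x. P x \<and> (\<forall>y. P y \<longrightarrow> \<not> L a x y)"
proof -
  obtain m where m: "P m" "\<And>y. P y \<Longrightarrow> card {w. L a m w} \<le> card {w. L a y w}"
    using ex_has_least_nat[of P x "\<lambda>x. card {w. L a x w}"] assms by blast
  have "\<not> L a m y" if "P y" for y
  proof
    assume my: "L a m y"
    have fin: "finite {w. L a m w}"
      by (rule finite_subset[OF _ finite_V]) (auto simp: L_def)
    have "{w. L a y w} \<subseteq> {w. L a m w}" using L_trans[OF my] by blast
    moreover have "y \<in> {w. L a m w}" "y \<notin> {w. L a y w}" using my L_distinct by auto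
    ultimately have "{w. L a y w} \<subset> {w. L a m w}" by blast
    then have "card {w. L a y w} < card {w. L a m w}" using psubset_card_mono[OF fin] by blast
    then show False using m(2)[OF that] by simp
  qed
  then show ?thesis using m(1) by blast
qed

lemma L_cyclic: "L a b c \<longleftrightarrow> L b c a"
  using L_rotate by blast

lemma diagonal_iff:
  assumes "a \<in> V" "b \<in> V" "a \<noteq> b"
  shows "closed_segment a b \<in> diagonals K \<longleftrightarrow> side a b \<noteq> {} \<and> side b a \<noteq> {}"
proof -
  have "closed_segment a b \<in> diagonals K \<longleftrightarrow> \<not> (closed_segment a b edge_of K)"
    using assms unfolding diagonals_def V_def[symmetric]
    by (auto simp: doubleton_eq_iff closed_segment_commute)
  then show ?thesis using edge_iff[OF assms] by blast
qed

lemma diagonalE: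
  assumes "d \<in> diagonals K"
  obtains a b where "a \<in> V" "b \<in> V" "a \<noteq> b" "d = closed_segment a b"
  using assms unfolding diagonals_def V_def[symmetric] by blast

lemma crossing_sym: "crossing d e \<longleftrightarrow> crossing e d"
  by (auto simp: crossing_def)

lemma crossing_irrefl: "\<not> crossing d d"
  by (simp add: crossing_def)

section \<open>The triangles of a triangulation\<close>

definition link :: "point set set \<Rightarrow> point \<Rightarrow> point \<Rightarrow> bool" where
  "link T a b \<longleftrightarrow> a \<in> V \<and> b \<in> V \<and> a \<noteq> b \<and>
     (closed_segment a b \<in> T \<or> side a b = {} \<or> side b a = {})"

lemma link_sym: "link T a b \<Longrightarrow> link T b a"
  by (auto simp: link_def closed_segment_commute)

lemma link_in:
  "\<lbrakk>link T a b; L a b c; L b a d\<rbrakk> \<Longrightarrow> closed_segment a b \<in> T"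
  by (auto simp: link_def side_def)

lemma triangulation_segE:
  assumes "triangulation K T" "d \<in> T"
  obtains a b where "a \<in> V" "b \<in> V" "a \<noteq> b" "d = closed_segment a b" "link T a b"
  using assms diagonalE[of d] unfolding triangulation_def link_def by blast

lemma L_cross_swap: "\<lbrakk>L a b c; L b a d\<rbrakk> \<Longrightarrow> L c d b \<and> L d c a"
  by (metis L_cyclic L_trans)

text \<open>Two segments that cross have vertices on both sides, so neither is a boundary edge and
  both belong to \<open>T\<close>.\<close>

lemma link_not_cross:
  assumes "triangulation K T" "link T a b" "link T c d" "L a b c" "L b a d"
  shows False
proof -
  have "L c d b" "L d c a" using assms L_cross_swap by blast+
  then have T: "closed_segment a b \<in> T" "closed_segment c d \<in> T"
    using assms link_in by blast+
  have "crossing (closed_segment a b) (closed_segment c d)"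
    using crossing_iff assms unfolding link_def by blast
  then show False using T assms(1) by (auto simp: triangulation_def noncrossing_def)
qed

lemma insert_noncrossing:
  "noncrossing (insert d T) \<longleftrightarrow> noncrossing T \<and> (\<forall>e\<in>T. \<not> crossing d e)"
proof -
  have "crossing e d \<longleftrightarrow> crossing d e" for e by (rule crossing_sym)
  then show ?thesis by (simp add: noncrossing_def crossing_irrefl ball_conj_distrib) blast
qed

lemma not_link_cross:
  assumes "triangulation K T" "a \<in> V" "b \<in> V" "a \<noteq> b" "\<not> link T a b"
  obtains c d where "link T c d" "closed_segment c d \<in> T" "L a b c" "L b a d"
proof -
  have "closed_segment a b \<in> diagonals K" "closed_segment a b \<notin> T"
    using assms diagonal_iff unfolding link_def by auto
  then have "\<not> noncrossing (insert (closed_segment a b) T)"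
    using assms(1) by (auto simp: triangulation_def)
  then obtain e where e: "e \<in> T" "crossing (closed_segment a b) e"
    using assms(1) unfolding insert_noncrossing triangulation_def by blast
  obtain c d where cd: "c \<in> V" "d \<in> V" "c \<noteq> d" "e = closed_segment c d" "link T c d"
    using triangulation_segE[OF assms(1) e(1)] by blast
  then have "L a b c \<and> L b a d \<or> L a b d \<and> L b a c"
    using crossing_iff assms e by blast
  then show ?thesis
    using that cd e(1) link_sym closed_segment_commute by metis
qed

text \<open>The apex \<open>x\<close> is the end of the first link from \<open>a\<close> after
  \<open>b\<close>. If \<open>x b\<close> were not a link, some link \<open>c d\<close> would cross
  it, with \<open>d\<close> between \<open>b\<close> and \<open>x\<close>. As it crosses neither
  \<open>a b\<close> nor \<open>a x\<close>, it has to start at \<open>c = a\<close>, and then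
  \<open>d\<close> contradicts the choice of \<open>x\<close>.\<close>

lemma triangle:
  assumes T: "triangulation K T" and ab: "link T a b" "L a b c"
  obtains x where "L a b x" "link T a x" "link T x b"
proof -
  \<comment> \<open>The last vertex counted from \<open>a\<close> is a neighbour of
    \<open>a\<close>, which provides a first candidate for the apex.\<close>
  obtain x0 where x0: "L a b x0" "\<And>y. L a b y \<Longrightarrow> \<not> L a x0 y"
    using last_exists[of "L a b" c a, OF ab(2)] by blast
  have "side a x0 = {}"
    using x0 L_trans[OF x0(1)] unfolding side_def by blast
  then have "L a b x0 \<and> link T a x0"
    using x0(1) L_V[OF x0(1)] L_distinct[OF x0(1)] unfolding link_def by blast
  then obtain x where x: "L a b x" "link T a x"
    and first: "\<And>y. L a b y \<Longrightarrow> link T a y \<Longrightarrow> \<not> L a y x"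
    using first_exists[of "\<lambda>x. L a b x \<and> link T a x" x0 a] by blast
  have "link T b x"
  proof (rule ccontr)
    assume "\<not> link T b x"
    moreover have "b \<in> V" "x \<in> V" "b \<noteq> x" using x L_V L_distinct by metis+
    ultimately obtain c d where cd: "link T c d" "L b x c" "L x b d"
      using not_link_cross[OF T] by metis
    have V: "a \<in> V" "c \<in> V" "d \<in> V" using ab cd by (auto simp: link_def)
    have "L b x a" "L x a b" using x(1) L_cyclic by blast+
    then have "L b d a" "L x a d"
      using cd L_trans[of b d x a] L_trans[of x a b d] L_cyclic by blast+
    then have "L a b d" using L_cyclic by blast
    then have "\<not> L b a c"
      using link_not_cross[OF T ab(1) link_sym[OF cd(1)]] by blast
    moreover have "\<not> (L a x c \<and> L x a d)"
      using link_not_cross[OF T x(2) cd(1)] by blast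
    moreover have "L a x c" if "L a b c"
      using L_trans[of c a b x] that cd(2) L_cyclic by metis
    ultimately have "a = c"
      using L_total[of a b c] V ab \<open>L x a d\<close> L_distinct[OF cd(2)] unfolding link_def by blast
    moreover have "L a d x" using \<open>L x a d\<close> L_cyclic by blast
    ultimately show False using first[of d] cd \<open>L a b d\<close> by blast
  qed
  then show ?thesis using that x link_sym by blast
qed

section \<open>The flip of a single diagonal\<close>

text \<open>In the quadrilateral with corners \<open>a\<close>, \<open>y\<close>, \<open>b\<close>,
  \<open>x\<close>, a segment that crosses \<open>x y\<close> leaves on the side of \<open>b\<close>
  either through \<open>b\<close> or across one of the two sides that meet there.\<close>

lemma quadrilateral_cases:
  assumes "L a b x" "L b a y" "L x y c" "L y x d"
  shows "c = b \<or> L b y c \<and> L y b d \<or> L x b c \<and> L b x d"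
proof -
  have "L b y c \<or> L x b c" if "c \<noteq> b"
  proof -
    have "b \<in> V" "b \<noteq> x" "b \<noteq> y" using assms(1,2) L_V L_distinct by blast+
    then have "L b y c \<or> L y b c" "L x b c \<or> L b x c"
      using that assms(3) L_V[OF assms(3)] L_distinct[OF assms(3)] L_total by blast+
    moreover have "\<not> (L y b c \<and> L b x c)"
      using L_trans[of c y b x] L_asym[OF assms(3)] L_cyclic by metis
    ultimately show ?thesis by blast
  qed
  moreover have "L y b d" if "L b y c"
    using that assms L_cyclic L_trans by metis
  moreover have "L b x d" if "L x b c"
    using that assms L_cyclic L_trans by metis
  ultimately show ?thesis by blast
qed

text \<open>The two triangles on \<open>a b\<close> form a quadrilateral, and a segment crossing one
  of its diagonals but none of its sides is the other diagonal. For members of \<open>T\<close> this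
  shows that none besides \<open>a b\<close> crosses \<open>x y\<close>; for a diagonal that could
  still be added it shows maximality.\<close>

lemma flip_exists:
  assumes T: "triangulation K T" and abT: "closed_segment a b \<in> T"
    and xy: "L a b x" "L b a y"
    and links: "link T a x" "link T x b" "link T a y" "link T y b"
  shows "flips_to K T (closed_segment a b) (closed_segment x y)"
    and "closed_segment x y \<notin> T" "crossing (closed_segment a b) (closed_segment x y)"
proof -
  have V: "a \<in> V" "b \<in> V" "x \<in> V" "y \<in> V" and ne: "a \<noteq> b" "x \<noteq> y"
    using L_V[OF xy(1)] L_V[OF xy(2)] L_distinct[OF xy(1)] L_asym[OF xy(1)] xy(2) by auto
  then have ab: "link T a b" using abT by (simp add: link_def)
  have xy': "L x y b" "L y x a" using xy L_cross_swap by blast+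
  show cross: "crossing (closed_segment a b) (closed_segment x y)"
    using crossing_iff V ne xy by blast
  then show notin: "closed_segment x y \<notin> T"
    using T abT by (auto simp: triangulation_def noncrossing_def)
  define T2 where "T2 = insert (closed_segment x y) (T - {closed_segment a b})"
  have diag: "closed_segment x y \<in> diagonals K"
    using diagonal_iff[OF V(3,4) ne(2)] xy' by (auto simp: side_def)
  have "\<not> crossing (closed_segment x y) e" if e: "e \<in> T" "e \<noteq> closed_segment a b" for e
  proof
    assume c: "crossing (closed_segment x y) e"
    obtain c d where cd: "c \<in> V" "d \<in> V" "c \<noteq> d" "e = closed_segment c d" "link T c d"
      using triangulation_segE[OF T e(1)] by blast
    have no: "\<not> (L x y c \<and> L y x d)" if "link T c d" "{c, d} \<noteq> {a, b}" for c d
    proof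
      assume c: "L x y c \<and> L y x d"
      have "\<not> (L a b c \<and> L b a d)" "\<not> (L b a c \<and> L a b d)"
        "\<not> (L a x c \<and> L x a d)" "\<not> (L x a c \<and> L a x d)"
        "\<not> (L x b c \<and> L b x d)" "\<not> (L b x c \<and> L x b d)"
        "\<not> (L a y c \<and> L y a d)" "\<not> (L y a c \<and> L a y d)"
        "\<not> (L y b c \<and> L b y d)" "\<not> (L b y c \<and> L y b d)"
        using link_not_cross[OF T] ab links link_sym that(1) by metis+
      then have "c = b" "d = a"
        using quadrilateral_cases[OF xy(1,2), of c d] quadrilateral_cases[OF xy(2,1), of d c] c
        by blast+
      then show False using that by blast
    qed
    have "{c, d} \<noteq> {a, b}" using e cd by (auto simp: doubleton_eq_iff)
    then show False
      using c no[of c d] no[of d c] cd link_sym crossing_iff[OF V(3,4) ne(2) cd(1,2,3)]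
      by (metis insert_commute)
  qed
  then have nc: "noncrossing T2"
    using T crossing_sym unfolding T2_def insert_noncrossing
    by (auto simp: triangulation_def noncrossing_def)
  have "f \<in> T2" if f: "f \<in> diagonals K" "noncrossing (insert f T2)" for f
  proof (rule ccontr)
    assume nf: "f \<notin> T2"
    obtain c d where cd: "c \<in> V" "d \<in> V" "c \<noteq> d" "f = closed_segment c d"
      using diagonalE[OF f(1)] by blast
    have fn: "\<not> crossing f e" if "e \<in> T2" for e
      using f(2) that unfolding insert_noncrossing by blast
    show False
    proof (cases "crossing f (closed_segment a b)")
      case False
      then have "f \<in> T"
        using fn f T unfolding triangulation_def insert_noncrossing T2_def by blast
      then have "f = closed_segment a b" using nf by (auto simp: T2_def)
      then show False using fn[of "closed_segment x y"] cross by (simp add: T2_def)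
    next
      case True
      have no: False if cd: "c \<in> V" "d \<in> V" "c \<noteq> d" "f = closed_segment c d"
        and L: "L a b c" "L b a d" for c d
      proof -
        have l: "\<not> (L p q c \<and> L q p d)" "\<not> (L q p c \<and> L p q d)" if "link T p q" "{p, q} \<noteq> {a, b}" for p q
        proof -
          have pq: "p \<in> V" "q \<in> V" "p \<noteq> q" using that by (auto simp: link_def)
          have "closed_segment p q \<noteq> closed_segment a b"
            using that(2) by simp
          then have "\<not> crossing f (closed_segment p q)" if "closed_segment p q \<in> T"
            using fn that unfolding T2_def by blast
          then show "\<not> (L p q c \<and> L q p d)" "\<not> (L q p c \<and> L p q d)"
            using crossing_iff[OF pq cd(1-3)] link_in[OF \<open>link T p q\<close>] crossing_sym cd(4) by blast+
        qed
        have ns: "{a, x} \<noteq> {a, b}" "{x, b} \<noteq> {a, b}" "{a, y} \<noteq> {a, b}" "{y, b} \<noteq> {a, b}"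
          using xy L_distinct by (auto simp: doubleton_eq_iff)
        have "c = x" "d = y"
          using l[OF links(1) ns(1)] l[OF links(2) ns(2)] l[OF links(3) ns(3)] l[OF links(4) ns(4)]
            quadrilateral_cases[OF xy'(2,1) L] quadrilateral_cases[OF xy'(1,2) L(2,1)]
          by blast+
        then show False using nf cd by (simp add: T2_def)
      qed
      have "f = closed_segment d c" using cd(4) by (simp add: closed_segment_commute)
      moreover have "crossing (closed_segment a b) (closed_segment c d)"
        using True cd(4) crossing_sym by metis
      ultimately show False
        using crossing_iff[OF V(1,2) ne(1) cd(1-3)] no[OF cd] no[OF cd(2,1) cd(3)[symmetric]]
        by blast
    qed
  qed
  then have "triangulation K T2"
    using nc diag T unfolding triangulation_def T2_def by blast
  then show "flips_to K T (closed_segment a b) (closed_segment x y)"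
    using T abT notin unfolding flips_to_def T2_def by metis
qed

text \<open>The flip of the first diagonal met on the way from \<open>u\<close> to \<open>w\<close> creates a diagonal ending
  in \<open>u\<close>.\<close>

lemma flip_towards:
  assumes T: "triangulation K T" and uw: "u \<in> V" "w \<in> V" "u \<noteq> w" "\<not> link T u w"
  obtains d y where "d \<in> T" "crossing (closed_segment u w) d" "y \<in> V" "y \<noteq> u"
    "flips_to K T d (closed_segment u y)" "closed_segment u y \<notin> T"
proof -
  obtain v where "L w u v"
    using uw unfolding link_def side_def by blast
  then have "L u v w" using L_rotate by blast
  then obtain l0 where l0: "L u l0 w" "\<And>y. L u y w \<Longrightarrow> \<not> L u y l0"
    using first_exists[of "\<lambda>x. L u x w" v u] by blast
  have "link T u l0"
  proof -
    have "\<not> L l0 u y" for y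
    proof
      assume "L l0 u y"
      then have "L u y l0" using L_rotate by blast
      then show False using l0 L_trans by blast
    qed
    then show ?thesis using l0 L_V L_distinct unfolding link_def side_def by blast
  qed
  \<comment> \<open>Among the links of \<open>u\<close>, \<open>l\<close> is the last one before
    \<open>w\<close>. The triangle on its far side has its apex \<open>r\<close> beyond
    \<open>w\<close>, so \<open>l r\<close> is the diagonal that is met first.\<close>
  then obtain l where l: "L u l w" "link T u l"
    and last: "\<And>y. L u y w \<Longrightarrow> link T u y \<Longrightarrow> \<not> L u l y"
    using last_exists[of "\<lambda>x. L u x w \<and> link T u x" l0 u] l0 by blast
  obtain r where r: "L u l r" "link T u r" "link T r l"
    using triangle[OF T l(2,1)] by blast
  have "r \<noteq> w" using r uw by blast
  then have "L u w r"
    using l r last[of r] uw L_total[of u r w] L_V[OF r(1)] L_distinct[OF r(1)]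
      L_total[of u w r] L_cyclic[of r u w] by metis
  have lr: "L l r u" "L r l w"
    using l(1) r(1) \<open>L u w r\<close> L_trans[of w r u l] L_cyclic by metis+
  obtain y where y: "L r l y" "link T r y" "link T y l"
    using triangle[OF T r(3) lr(2)] by blast
  have V: "l \<in> V" "r \<in> V" "l \<noteq> r" using lr L_V L_distinct by metis+
  have lrT: "closed_segment l r \<in> T"
    using link_in[OF link_sym[OF r(3)]] lr by blast
  have "L u w r \<and> L w u l" using \<open>L u w r\<close> l L_rotate by blast
  then have "crossing (closed_segment u w) (closed_segment l r)"
    using crossing_iff[OF uw(1-3) V] by blast
  moreover have "y \<in> V" "y \<noteq> u" using y lr L_V L_asym by metis+
  ultimately show ?thesis
    using that[OF lrT] flip_exists[OF T lrT lr(1) y(1)] l r y link_sym by blast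
qed

section \<open>Central symmetry\<close>

definition mirrored :: "point set \<Rightarrow> point set" where
  "mirrored d = reflect z ` d"

lemma mirrored_mirrored [simp]: "mirrored (mirrored d) = d"
  by (simp add: mirrored_def)

lemma mirrored_eq_iff [simp]: "mirrored d = mirrored e \<longleftrightarrow> d = e"
  by (metis mirrored_mirrored)

lemma sym_orbit_mirrored: "sym_orbit z d = {d, mirrored d}"
  by (simp add: sym_orbit_def mirrored_def)

lemma cs_triangulations_iff:
  "T \<in> cs_triangulations K z \<longleftrightarrow> triangulation K T \<and> (\<forall>d\<in>T. mirrored d \<in> T)"
  by (simp add: cs_triangulations_def mirrored_def)

lemma mirrored_segment:
  "mirrored (closed_segment a b) = closed_segment (mirror a) (mirror b)"
  by (simp add: reflect_closed_segment mirror_def mirrored_def)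

lemma mirror_inject [simp]: "mirror a = mirror b \<longleftrightarrow> a = b"
  by (metis mirror_mirror)

lemma mirror_neq' [simp]: "a \<in> V \<Longrightarrow> a \<noteq> mirror a"
  using mirror_neq by metis

lemma L_irrefl [simp]: "\<not> L a a b" "\<not> L a b a" "\<not> L a b b"
  using L_distinct by blast+

lemma side_mirror: "side (mirror a) (mirror b) = mirror ` side a b"
proof -
  have "L (mirror a) (mirror b) x \<longleftrightarrow> L a b (mirror x)" for x
    using L_mirror[of a b "mirror x"] by simp
  moreover have "x \<in> mirror ` side a b \<longleftrightarrow> L a b (mirror x)" for x
    unfolding side_def image_iff using mirror_mirror by (metis mem_Collect_eq)
  ultimately show ?thesis
    unfolding set_eq_iff side_def[of "mirror a"] mem_Collect_eq by blast
qed

lemma mirrored_diagonal: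
  assumes "d \<in> diagonals K"
  shows "mirrored d \<in> diagonals K"
proof -
  obtain a b where "a \<in> V" "b \<in> V" "a \<noteq> b" "d = closed_segment a b"
    using diagonalE[OF assms] .
  then show ?thesis
    using assms by (simp add: mirrored_segment diagonal_iff side_mirror)
qed

lemma mirrored_crossing:
  assumes "d \<in> diagonals K" "e \<in> diagonals K"
  shows "crossing (mirrored d) (mirrored e) \<longleftrightarrow> crossing d e"
proof -
  obtain a b where "a \<in> V" "b \<in> V" "a \<noteq> b" "d = closed_segment a b"
    using diagonalE[OF assms(1)] .
  moreover obtain p q where "p \<in> V" "q \<in> V" "p \<noteq> q" "e = closed_segment p q"
    using diagonalE[OF assms(2)] .
  ultimately show ?thesis
    by (simp add: mirrored_segment crossing_iff)
qed

lemma mirrored_crossing':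
  assumes "d \<in> diagonals K" "e \<in> diagonals K"
  shows "crossing (mirrored d) e \<longleftrightarrow> crossing d (mirrored e)"
  using mirrored_crossing[OF assms(1) mirrored_diagonal[OF assms(2)]] by simp

text \<open>The two segments are parallel. In terms of the order, the half turn preserves
  \<open>L\<close>, and a crossing would make \<open>b\<close>, \<open>mirror a\<close> and
  \<open>mirror b\<close> a cycle in the order seen from \<open>a\<close>, in one direction or the
  other.\<close>

lemma not_crossing_mirrored:
  assumes "d \<in> diagonals K"
  shows "\<not> crossing d (mirrored d)"
proof
  assume c: "crossing d (mirrored d)"
  obtain a b where ab: "a \<in> V" "b \<in> V" "a \<noteq> b" "d = closed_segment a b"
    using diagonalE[OF assms] .
  then have "L a b (mirror a) \<and> L b a (mirror b) \<or> L a b (mirror b) \<and> L b a (mirror a)"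
    using c crossing_iff[of a b "mirror a" "mirror b"] by (simp add: mirrored_segment)
  then show False
  proof
    assume 1: "L a b (mirror a) \<and> L b a (mirror b)"
    then have "L (mirror a) (mirror b) a"
      using L_mirror[of a b "mirror a"] by simp
    then have "L a (mirror a) (mirror b)" "L a (mirror b) b" using 1 L_cyclic by blast+
    then show False using 1 L_trans L_distinct by blast
  next
    assume 2: "L a b (mirror b) \<and> L b a (mirror a)"
    then have "L (mirror b) (mirror a) a"
      using L_mirror[of b a "mirror a"] by simp
    then have "L a (mirror b) (mirror a)" "L a (mirror a) b" using 2 L_cyclic by blast+
    then show False using 2 L_trans L_distinct by blast
  qed
qed

lemma central_iff_fixed:
  assumes "d \<in> diagonals K"
  shows "central z d \<longleftrightarrow> mirrored d = d"
proof -
  obtain a b where ab: "a \<in> V" "b \<in> V" "a \<noteq> b" "d = closed_segment a b"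
    using diagonalE[OF assms] .
  then have "central z d \<longleftrightarrow> b = mirror a" using central_iff by blast
  moreover have "mirrored d = d \<longleftrightarrow> b = mirror a"
    using ab mirror_neq[of a] mirror_neq[of b] by (auto simp: mirrored_segment doubleton_eq_iff)
  ultimately show ?thesis by blast
qed

lemma centralE:
  assumes "d \<in> diagonals K" "central z d"
  obtains u where "u \<in> V" "d = closed_segment u (mirror u)"
  using diagonalE[OF assms(1)] assms(2) central_iff by metis

text \<open>The half turn exchanges the sides of a central diagonal, so the ends of another one lie
  on different sides.\<close>

lemma central_crossing:
  assumes "d \<in> diagonals K" "e \<in> diagonals K" "central z d" "central z e" "d \<noteq> e"
  shows "crossing d e"
proof -
  obtain u where u: "u \<in> V" "d = closed_segment u (mirror u)"
    using centralE assms by blast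
  obtain v where v: "v \<in> V" "e = closed_segment v (mirror v)"
    using centralE assms by blast
  have "v \<noteq> u" "v \<noteq> mirror u" using u v assms(5) by (auto simp: closed_segment_commute)
  then have "L u (mirror u) v \<or> L (mirror u) u v"
    using u v L_total by simp
  moreover have "L u (mirror u) v \<longleftrightarrow> L (mirror u) u (mirror v)"
    "L (mirror u) u v \<longleftrightarrow> L u (mirror u) (mirror v)"
    using L_mirror[of u "mirror u" v] L_mirror[of "mirror u" u v] by simp_all
  ultimately show ?thesis
    unfolding u(2) v(2) using crossing_iff[of u "mirror u" v "mirror v"] u v by auto
qed

lemma finite_diagonals: "finite (diagonals K)"
proof -
  have "diagonals K \<subseteq> (\<lambda>(a, b). closed_segment a b) ` (V \<times> V)"
  proof
    fix d assume "d \<in> diagonals K"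
    then obtain a b where "a \<in> V" "b \<in> V" "d = closed_segment a b" using diagonalE by metis
    then show "d \<in> (\<lambda>(a, b). closed_segment a b) ` (V \<times> V)" by force
  qed
  then show ?thesis using finite_V finite_subset by blast
qed

text \<open>The half turn exchanges the two sides, so each contains half of the remaining
  \<open>2 * n + 2\<close> vertices.\<close>

lemma central_sides:
  assumes "u \<in> V"
  shows "card (side u (mirror u)) = n + 1"
proof -
  have eq: "V = {u, mirror u} \<union> (side u (mirror u) \<union> side (mirror u) u)"
    using assms L_total[of u "mirror u"] L_V by (auto simp: side_def)
  have disj: "side u (mirror u) \<inter> side (mirror u) u = {}"
    "{u, mirror u} \<inter> (side u (mirror u) \<union> side (mirror u) u) = {}"
    using L_asym L_irrefl by (auto simp: side_def)
  have "side (mirror u) u = mirror ` side u (mirror u)"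
    using side_mirror[of u "mirror u"] by simp
  then have "card (side (mirror u) u) = card (side u (mirror u))"
    by (simp add: card_image inj_on_def)
  moreover have "card {u, mirror u} = 2" using assms mirror_neq' by simp
  ultimately have "card V = 2 + 2 * card (side u (mirror u))"
    using disj finite_side card_Un_disjoint[of "{u, mirror u}" "side u (mirror u) \<union> side (mirror u) u"]
      card_Un_disjoint[of "side u (mirror u)" "side (mirror u) u"] eq by auto
  then show ?thesis using card_V by simp
qed

lemma central_diagonal:
  assumes "u \<in> V"
  shows "side u (mirror u) \<noteq> {}" "side (mirror u) u \<noteq> {}"
    "closed_segment u (mirror u) \<in> diagonals K"
proof -
  show s: "side u (mirror u) \<noteq> {}" "side (mirror u) u \<noteq> {}"
    using central_sides[of u] central_sides[of "mirror u"] assms by auto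
  show "closed_segment u (mirror u) \<in> diagonals K"
    using s assms diagonal_iff by simp
qed

section \<open>Centrally symmetric triangulations and their central diagonal\<close>

lemma cs_triangulation: "T \<in> cs_triangulations K z \<Longrightarrow> triangulation K T"
  by (simp add: cs_triangulations_iff)

lemma cs_mirrored [simp]:
  "T \<in> cs_triangulations K z \<Longrightarrow> mirrored d \<in> T \<longleftrightarrow> d \<in> T"
  unfolding cs_triangulations_iff by (metis mirrored_mirrored)

lemma triangulation_diagonal: "\<lbrakk>triangulation K T; d \<in> T\<rbrakk> \<Longrightarrow> d \<in> diagonals K"
  by (auto simp: triangulation_def)

lemma triangulation_not_crossing:
  "\<lbrakk>triangulation K T; d \<in> T; e \<in> T\<rbrakk> \<Longrightarrow> \<not> crossing d e"
  by (auto simp: triangulation_def noncrossing_def)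

lemma triangulation_maximal:
  assumes "triangulation K T" "d \<in> diagonals K" "\<And>e. e \<in> T \<Longrightarrow> \<not> crossing d e"
  shows "d \<in> T"
  using assms unfolding triangulation_def insert_noncrossing by blast

lemma triangulationI:
  assumes "T \<subseteq> diagonals K" "\<And>d e. d \<in> T \<Longrightarrow> e \<in> T \<Longrightarrow> \<not> crossing d e"
    "\<And>d. d \<in> diagonals K \<Longrightarrow> (\<And>e. e \<in> T \<Longrightarrow> \<not> crossing d e) \<Longrightarrow> d \<in> T"
  shows "triangulation K T"
  using assms unfolding triangulation_def insert_noncrossing by (simp add: noncrossing_def)

lemma triangulation_subset_eq:
  assumes "triangulation K T" "triangulation K T'" "T \<subseteq> T'"
  shows "T = T'"
  using assms triangulation_maximal[OF assms(1)] triangulation_not_crossing[OF assms(2)]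
    triangulation_diagonal[OF assms(2)] by blast

lemma triangulation_finite: "triangulation K T \<Longrightarrow> finite T"
  using finite_diagonals finite_subset unfolding triangulation_def by blast

lemma mirrored_triangulation:
  assumes "triangulation K T"
  shows "triangulation K (mirrored ` T)"
proof (rule triangulationI)
  show "mirrored ` T \<subseteq> diagonals K"
    using triangulation_diagonal[OF assms] mirrored_diagonal by blast
  show "\<not> crossing d e" if "d \<in> mirrored ` T" "e \<in> mirrored ` T" for d e
    using that mirrored_crossing triangulation_diagonal[OF assms]
      triangulation_not_crossing[OF assms] by auto
  show "d \<in> mirrored ` T"
    if d: "d \<in> diagonals K" "\<And>e. e \<in> mirrored ` T \<Longrightarrow> \<not> crossing d e" for d
  proof -
    have "\<not> crossing (mirrored d) e" if "e \<in> T" for e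
      using d that mirrored_crossing' triangulation_diagonal[OF assms that] by blast
    then have "mirrored d \<in> T"
      using triangulation_maximal[OF assms mirrored_diagonal[OF d(1)]] by blast
    then show ?thesis by (metis imageI mirrored_mirrored)
  qed
qed

text \<open>A maximal symmetric noncrossing set is a triangulation: if a diagonal can be added, then
  so can its mirror image, and the two do not cross each other.\<close>

lemma cs_extension:
  assumes "D \<subseteq> diagonals K" "noncrossing D" "\<And>d. d \<in> D \<Longrightarrow> mirrored d \<in> D"
  shows "\<exists>T \<in> cs_triangulations K z. D \<subseteq> T"
proof -
  let ?P = "\<lambda>T. D \<subseteq> T \<and> T \<subseteq> diagonals K \<and> noncrossing T \<and> (\<forall>d\<in>T. mirrored d \<in> T)"
  define F where "F = {T. ?P T}"
  have "F \<subseteq> Pow (diagonals K)" by (auto simp: F_def)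
  then have "finite F" using finite_diagonals finite_subset by blast
  moreover have "D \<in> F" using assms by (auto simp: F_def)
  ultimately obtain T where T': "T \<in> F" and max': "\<forall>S\<in>F. T \<subseteq> S \<longrightarrow> T = S"
    using finite_has_maximal2[of F D] by metis
  have T: "?P T" using T' by (simp add: F_def)
  have max: "S = T" if "?P S" "T \<subseteq> S" for S
    using max' that(2) that(1)[folded mem_Collect_eq[of S ?P], folded F_def] by blast
  have "triangulation K T"
  proof (rule triangulationI)
    show "d \<in> T" if d: "d \<in> diagonals K" "\<And>e. e \<in> T \<Longrightarrow> \<not> crossing d e" for d
    proof -
      have nc: "\<not> crossing (mirrored d) e" if "e \<in> T" for e
        using T d that mirrored_crossing' by blast
      define S where "S = insert d (insert (mirrored d) T)"
      have "noncrossing S"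
        unfolding S_def insert_noncrossing using T d not_crossing_mirrored nc by blast
      moreover have DS: "D \<subseteq> S" "T \<subseteq> S" using T by (auto simp: S_def)
      moreover have "S \<subseteq> diagonals K"
        using T d(1) mirrored_diagonal by (simp add: S_def)
      moreover have "\<forall>e\<in>S. mirrored e \<in> S"
        using T by (auto simp: S_def)
      ultimately have "?P S" by (intro conjI)
      then have "S = T" by (rule max[OF _ DS(2)])
      have "d \<in> S" by (simp add: S_def)
      then show ?thesis unfolding \<open>S = T\<close> .
    qed
  qed (use T in \<open>auto simp: noncrossing_def\<close>)
  then show ?thesis using T by (intro bexI[of _ T]) (auto simp: cs_triangulations_iff)
qed

lemma cs_link_mirror:
  assumes "T \<in> cs_triangulations K z" "link T a b"
  shows "link T (mirror a) (mirror b)"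
proof -
  have "closed_segment (mirror a) (mirror b) \<in> T \<longleftrightarrow> closed_segment a b \<in> T"
    using cs_mirrored[OF assms(1), of "closed_segment a b"] by (simp add: mirrored_segment)
  then show ?thesis using assms(2) by (auto simp: link_def side_mirror)
qed

text \<open>Take a directed side of the triangulation with the centre on its left and as few vertices
  as possible on its left. Unless it lies on a central diagonal, the triangle on its left contains
  the centre in its interior, and then so does the mirror image of that triangle, which it has
  to cross.\<close>

lemma cs_central_exists:
  assumes T: "T \<in> cs_triangulations K z"
  shows "\<exists>c\<in>T. central z c"
proof (rule ccontr)
  assume no: "\<not> ?thesis"
  have tri: "triangulation K T" using T cs_triangulation by blast
  have nolink: "\<not> link T u (mirror u)" for u
  proof
    assume l: "link T u (mirror u)"
    then have u: "u \<in> V" by (simp add: link_def)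
    then have "closed_segment u (mirror u) \<in> T"
      using l central_diagonal[OF u] unfolding link_def by blast
    then show False using no central_iff[of u "mirror u"] u by auto
  qed
  \<comment> \<open>As the centre is the midpoint of a vertex and its mirror image, the second
    condition says that the centre is on the left.\<close>
  let ?P = "\<lambda>e. link T (fst e) (snd e) \<and> L (fst e) (snd e) (mirror (fst e))"
  have "V \<noteq> {}" using card_V by auto
  then obtain a where a: "a \<in> V" by blast
  \<comment> \<open>The minimum needs a starting point: the boundary edge from \<open>a\<close> to
    its counterclockwise successor has the whole polygon on its left.\<close>
  have "\<exists>b. (b \<in> V \<and> b \<noteq> a) \<and> (\<forall>y. y \<in> V \<and> y \<noteq> a \<longrightarrow> \<not> L a y b)"
    using first_exists[of "\<lambda>b. b \<in> V \<and> b \<noteq> a" "mirror a" a] a mirror_neq by simp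
  then obtain b where b: "b \<in> V" "b \<noteq> a" "\<And>y. y \<in> V \<Longrightarrow> y \<noteq> a \<Longrightarrow> \<not> L a y b"
    by blast
  have e: "side b a = {}"
  proof -
    have "\<not> L b a y" for y
      using b(3)[of y] L_cyclic[of b a y] L_V[of b a y] L_distinct[of b a y] by blast
    then show ?thesis by (simp add: side_def)
  qed
  then have ab: "link T a b" using a b by (auto simp: link_def)
  then have "b \<noteq> mirror a" using nolink by blast
  then have "L a b (mirror a)"
    using L_total[of a b "mirror a"] a b e mirror_neq[of a] by (auto simp: side_def)
  with ab have "?P (a, b)" by simp
  from ex_has_least_nat[of ?P, OF this, of "\<lambda>e. card (side (fst e) (snd e))"]
  obtain a b where ab: "link T a b" "L a b (mirror a)"
    and min: "\<And>p q. link T p q \<Longrightarrow> L p q (mirror p) \<Longrightarrow> card (side a b) \<le> card (side p q)"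
    by (metis fst_conv snd_conv)
  obtain x where x: "L a b x" "link T a x" "link T x b"
    using triangle[OF tri ab] by blast
  have V: "a \<in> V" "b \<in> V" "x \<in> V" using x L_V by blast+
  have ne: "x \<noteq> mirror a" "x \<noteq> mirror b"
    using nolink[of a] nolink[of b] x(2) link_sym[OF x(3)] by auto
  have less: "card (side p q) < card (side a b)" if "side p q \<subseteq> side a b" "x \<notin> side p q" for p q
    using that x(1) by (intro psubset_card_mono[OF finite_side]) (auto simp: side_def)
  have "side a x \<subseteq> side a b"
    unfolding side_def using L_trans[OF x(1)] by blast
  moreover have "side x b \<subseteq> side a b"
  proof -
    have "L a b y" if "L x b y" for y
      using L_trans[of b y x a] that x(1) L_cyclic by metis
    then show ?thesis by (auto simp: side_def)
  qed
  moreover have "x \<notin> side a x" "x \<notin> side x b" using L_distinct by (auto simp: side_def)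
  ultimately have no_ax: "\<not> L a x (mirror a)" and no_xb: "\<not> L x b (mirror x)"
    using min[OF x(2)] min[OF x(3)] less[of a x] less[of x b] by fastforce+
  have "L x a (mirror a)"
    using L_total[of a x "mirror a"] no_ax V ne mirror_neq[of a] x L_distinct by auto
  then have "L (mirror x) (mirror a) a"
    using L_mirror[of x a "mirror a"] by simp
  have "L b x (mirror x)"
    using L_total[of b x "mirror x"] L_distinct[OF x(1)] no_xb V ne mirror_neq[of x]
    by (metis L_cyclic L_total mirror_V mirror_mirror)
  \<comment> \<open>Since \<open>mirror a\<close> is to the left of \<open>a b\<close>, this makes
    the mirror image of the link \<open>a x\<close> cross \<open>a b\<close>.\<close>
  have "L b a (mirror x)"
  proof (rule ccontr)
    assume n: "\<not> ?thesis"
    have "mirror x \<noteq> a" "mirror x \<noteq> b" using ne by auto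
    then have "L a b (mirror x)"
      using n L_total[of a b "mirror x"] V L_distinct[OF x(1)] by auto
    moreover have "L a (mirror x) x"
      using \<open>L (mirror x) (mirror a) a\<close> \<open>L x a (mirror a)\<close> L_trans[of a "mirror x" "mirror a" x] L_cyclic
      by metis
    ultimately have "L x b (mirror x)"
      using L_trans[of "mirror x" x a b] L_cyclic by metis
    then show False using no_xb by blast
  qed
  then show False
    using link_not_cross[OF tri ab(1) cs_link_mirror[OF T link_sym[OF x(2)]]]
      link_not_cross[OF tri ab(1) cs_link_mirror[OF T x(2)] ab(2)] by blast
qed

lemma cs_central_unique:
  assumes "T \<in> cs_triangulations K z" "c \<in> T" "d \<in> T" "central z c" "central z d"
  shows "c = d"
  using assms central_crossing cs_triangulation triangulation_diagonal
    triangulation_not_crossing by metis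

lemma cs_central_diagonalE:
  assumes "T \<in> cs_triangulations K z"
  obtains u where "u \<in> V" "closed_segment u (mirror u) \<in> T"
  using assms cs_central_exists centralE cs_triangulation triangulation_diagonal by metis

section \<open>Separation by the central diagonal\<close>

text \<open>The ends are included because a diagonal that does not cross \<open>u v\<close> may
  share an end with it.\<close>

definition weakly_left :: "point \<Rightarrow> point \<Rightarrow> point \<Rightarrow> bool" where
  "weakly_left u v x \<longleftrightarrow> L u v x \<or> x = u \<or> x = v"

lemma weakly_left_sides:
  assumes "u \<in> V" "v \<in> V" "u \<noteq> v" "a \<in> V" "b \<in> V" "a \<noteq> b"
    and "\<not> crossing (closed_segment u v) (closed_segment a b)"
  shows "weakly_left u v a \<and> weakly_left u v b \<or> weakly_left v u a \<and> weakly_left v u b"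
proof -
  have t: "L u v x \<or> x = u \<or> x = v \<or> L v u x" if "x \<in> V" for x
    using L_total[of u v x] assms that by blast
  show ?thesis
    using assms(7) crossing_iff[OF assms(1-6)] t[OF assms(4)] t[OF assms(5)]
    unfolding weakly_left_def by blast
qed

text \<open>One of the two open arcs between \<open>a\<close> and \<open>b\<close> lies strictly to
  the left of \<open>u v\<close>, and a diagonal crossing \<open>a b\<close> has an end in each
  arc.\<close>

lemma weakly_left_crossing:
  assumes ab: "weakly_left u v a" "weakly_left u v b" and pq: "L a b p" "L b a q"
  shows "L u v p \<or> L u v q"
proof -
  have "a \<noteq> b" using pq by auto
  have b: "L b a q \<longleftrightarrow> L a q b" "L b a q \<longleftrightarrow> L q b a" "L a b p \<longleftrightarrow> L b p a" "L a b p \<longleftrightarrow> L p a b" using L_cyclic by blast+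
  consider "L u v a" "L u v b" | "L u v a" "b = u" | "L u v a" "b = v" | "a = u" "L u v b"
    | "a = u" "b = v" | "a = v" "L u v b" | "a = v" "b = u"
    using ab \<open>a \<noteq> b\<close> unfolding weakly_left_def by blast
  then show ?thesis
  proof cases
    case 1
    then have "a \<in> V" "b \<in> V" "v \<in> V" "v \<noteq> a" "v \<noteq> b" using L_V L_distinct by blast+
    then have "L v a b \<or> L v b a" using L_total[of v a b] \<open>a \<noteq> b\<close> L_cyclic by metis
    then show ?thesis
    proof
      assume "L v a b"
      then have "L v a q" "L v q b" using pq b L_trans[of a q b v] L_trans[of b v a q] L_cyclic by metis+
      moreover have "L v b u" using 1 L_cyclic by metis
      ultimately have "L v q u" using L_trans by metis
      then show ?thesis using L_cyclic by metis
    next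
      assume "L v b a"
      then have "L v p a" using pq b L_trans[of a v b p] L_cyclic by metis
      moreover have "L v a u" using 1 L_cyclic by metis
      ultimately have "L v p u" using L_trans by metis
      then show ?thesis using L_cyclic by metis
    qed
  qed (use pq in \<open>metis L_cyclic L_trans\<close>)+
qed

lemma segment_weakly_left:
  assumes "u \<in> V" "v \<in> V" "u \<noteq> v" "d \<in> diagonals K" "\<not> crossing (closed_segment u v) d"
  obtains u' v' a b where "{u', v'} = {u, v}" "weakly_left u' v' a" "weakly_left u' v' b"
    "d = closed_segment a b" "a \<in> V" "b \<in> V" "a \<noteq> b"
proof -
  obtain a b where ab: "a \<in> V" "b \<in> V" "a \<noteq> b" "d = closed_segment a b"
    using diagonalE[OF assms(4)] .
  then have "weakly_left u v a \<and> weakly_left u v b \<or> weakly_left v u a \<and> weakly_left v u b"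
    using weakly_left_sides[OF assms(1-3)] assms(5) by blast
  then show ?thesis
    using that[of u v a b] that[of v u a b] ab by (auto simp: insert_commute)
qed

lemma weakly_left_mirror:
  "weakly_left (mirror u) u (mirror a) \<longleftrightarrow> weakly_left u (mirror u) a"
  using L_mirror[of u "mirror u" a] by (auto simp: weakly_left_def)

lemma crossing_weakly_left:
  assumes "weakly_left u v a" "weakly_left u v b" "a \<in> V" "b \<in> V" "a \<noteq> b"
    and "p \<in> V" "q \<in> V" "p \<noteq> q" "crossing (closed_segment p q) (closed_segment a b)"
  shows "L u v p \<or> L u v q"
proof -
  have "L a b p \<and> L b a q \<or> L a b q \<and> L b a p"
    using crossing_iff[of a b p q] assms crossing_sym by metis
  then show ?thesis using weakly_left_crossing[OF assms(1,2)] by blast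
qed

text \<open>The central diagonal separates \<open>d\<close> and \<open>e\<close> from the mirror image of \<open>e\<close>.\<close>

lemma crossing_both_sides:
  assumes c: "u \<in> V" and d: "d \<in> diagonals K" "\<not> crossing (closed_segment u (mirror u)) d"
    and e: "e \<in> diagonals K" "\<not> crossing (closed_segment u (mirror u)) e"
    and de: "d = e \<or> crossing d e"
    and f: "f \<in> diagonals K" "crossing f d" "crossing f (mirrored e)"
  shows "crossing f (closed_segment u (mirror u))"
proof -
  obtain u' v' a b where "{u', v'} = {u, mirror u}" and wd: "weakly_left u' v' a" "weakly_left u' v' b"
    "d = closed_segment a b" "a \<in> V" "b \<in> V" "a \<noteq> b"
    using segment_weakly_left[of u "mirror u" d] c d mirror_neq'[OF c] by (metis mirror_V)
  then have u': "u' \<in> V" "v' = mirror u'" "closed_segment u (mirror u) = closed_segment u' (mirror u')"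
    using c by (auto simp: doubleton_eq_iff closed_segment_commute)
  obtain p q where pq: "p \<in> V" "q \<in> V" "p \<noteq> q" "e = closed_segment p q"
    using diagonalE[OF e(1)] .
  have wl: "weakly_left u' v' p \<and> weakly_left u' v' q"
  proof (cases "d = e")
    case True
    then show ?thesis using wd pq by (auto simp: doubleton_eq_iff)
  next
    case False
    then have "crossing (closed_segment p q) (closed_segment a b)"
      using de crossing_sym wd(3) pq(4) by metis
    \<comment> \<open>Since \<open>e\<close> crosses \<open>d\<close>, it has an end strictly on the
      side of \<open>d\<close>; this decides on which side all of \<open>e\<close> lies.\<close>
    then have "L u' v' p \<or> L u' v' q"
      using crossing_weakly_left[OF wd(1,2,4,5,6) pq(1-3)] by blast
    moreover have "weakly_left u' v' p \<and> weakly_left u' v' q \<or> weakly_left v' u' p \<and> weakly_left v' u' q"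
      using weakly_left_sides[of u' v' p q] u'(1,2) e(2)[unfolded u'(3) pq(4)] pq mirror_neq'[OF u'(1)]
      by simp
    moreover have "\<not> weakly_left v' u' x" if "L u' v' x" for x
      using that L_asym[OF that] by (auto simp: weakly_left_def)
    ultimately show ?thesis by blast
  qed
  then have wm: "weakly_left v' u' (mirror p)" "weakly_left v' u' (mirror q)"
    using weakly_left_mirror[of u'] u'(2) by simp_all
  obtain r s where rs: "r \<in> V" "s \<in> V" "r \<noteq> s" "f = closed_segment r s"
    using diagonalE[OF f(1)] .
  have "L u' v' r \<or> L u' v' s"
    using crossing_weakly_left[OF wd(1,2,4,5,6) rs(1-3)] f(2) rs(4) wd(3) by blast
  moreover have "L v' u' r \<or> L v' u' s"
    using crossing_weakly_left[OF wm _ _ _ rs(1-3)] f(3) pq rs(4) by (simp add: mirrored_segment)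
  ultimately have "L u' v' r \<and> L v' u' s \<or> L u' v' s \<and> L v' u' r"
    using L_asym by blast
  then have "crossing (closed_segment u' (mirror u')) (closed_segment r s)"
    using crossing_iff[of u' v' r s] u'(1,2) rs mirror_neq'[OF u'(1)] by simp
  then show ?thesis
    unfolding u'(3) rs(4) by (rule crossing_sym[THEN iffD1])
qed

section \<open>Simultaneous flips of mirror images\<close>

text \<open>Maximality of both triangulations yields what the definition of a flip leaves implicit.
  If \<open>e\<close> were in \<open>T\<close>, then \<open>d\<close> could be added to the new
  triangulation; if \<open>d\<close> and \<open>e\<close> did not cross, \<open>e\<close> could be
  added to \<open>T\<close>.\<close>

lemma flips_to_facts:
  assumes "flips_to K T d e"
  shows "triangulation K T" "d \<in> T" "e \<noteq> d" "triangulation K (insert e (T - {d}))"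
    and "e \<notin> T" "crossing d e" "d \<in> diagonals K" "e \<in> diagonals K"
proof -
  show *: "triangulation K T" "d \<in> T" "e \<noteq> d" "triangulation K (insert e (T - {d}))"
    using assms by (auto simp: flips_to_def)
  show dK: "d \<in> diagonals K" and eK: "e \<in> diagonals K"
    using * triangulation_diagonal by blast+
  show eT: "e \<notin> T"
  proof
    assume "e \<in> T"
    then have "d \<in> insert e (T - {d})"
      using triangulation_maximal[OF *(4) dK] triangulation_not_crossing[OF *(1,2)] by blast
    then show False using *(3) by blast
  qed
  show "crossing d e"
  proof (rule ccontr)
    assume "\<not> crossing d e"
    then have "\<not> crossing e g" if "g \<in> T" for g
      using that triangulation_not_crossing[OF *(4), of e g] crossing_sym by blast
    then show False using triangulation_maximal[OF *(1) eK] eT by blast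
  qed
qed

definition flip_result :: "point set set \<Rightarrow> point set \<Rightarrow> point set \<Rightarrow> point set set" where
  "flip_result T d e = (T - sym_orbit z d) \<union> sym_orbit z e"

lemma mirrored_image_flip:
  assumes T: "T \<in> cs_triangulations K z"
  shows "mirrored ` insert e (T - {d}) = insert (mirrored e) (T - {mirrored d})"
proof -
  have "mirrored ` (T - {d}) = T - {mirrored d}"
  proof (intro equalityI subsetI)
    fix x assume "x \<in> mirrored ` (T - {d})"
    then show "x \<in> T - {mirrored d}" using T by auto
  next
    fix x assume "x \<in> T - {mirrored d}"
    then have "mirrored x \<in> T - {d}" using T mirrored_eq_iff[of "mirrored x" d] by auto
    then show "x \<in> mirrored ` (T - {d})"
      by (intro image_eqI[of _ _ "mirrored x"]) simp
  qed
  then show ?thesis by simp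
qed

text \<open>If \<open>d\<close> is central, the mirror image of \<open>e\<close> crosses nothing in
  the new triangulation and is not in \<open>T\<close>, so it is \<open>e\<close>. Otherwise, a
  diagonal \<open>f\<close> that crosses nothing in the result \<open>R\<close> cannot cross both
  \<open>d\<close> and \<open>mirrored d\<close>, since it would then cross the central diagonal,
  which stays in \<open>R\<close>. Hence maximality of the flip on one side, or of its mirror image,
  applies to \<open>f\<close>.\<close>

lemma symmetric_flip:
  assumes T: "T \<in> cs_triangulations K z" and flip: "flips_to K T d e"
  shows "flip_result T d e \<in> cs_triangulations K z" "central z e \<longleftrightarrow> central z d"
proof -
  note F = flips_to_facts[OF flip]
  have "flip_result T d e \<in> cs_triangulations K z \<and> (central z e \<longleftrightarrow> central z d)"
  proof (cases "central z d")
    case True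
    then have fd: "mirrored d = d" using central_iff_fixed F by blast
    have "\<not> crossing (mirrored e) g" if g: "g \<in> insert e (T - {d})" for g
    proof (cases "g = e")
      case True
      then show ?thesis using not_crossing_mirrored[OF F(8)] crossing_sym by blast
    next
      case False
      then have "g \<in> T" "g \<noteq> d" using g by auto
      then have "mirrored g \<in> insert e (T - {d})"
        using fd T by (auto simp: mirrored_eq_iff[of g d, unfolded fd])
      then show ?thesis
        using mirrored_crossing'[OF F(8), of g] triangulation_diagonal[OF F(1) \<open>g \<in> T\<close>]
          triangulation_not_crossing[OF F(4)] by blast
    qed
    then have "mirrored e \<in> insert e (T - {d})"
      using triangulation_maximal[OF F(4) mirrored_diagonal[OF F(8)]] by blast
    moreover have "mirrored e \<notin> T" using F(5) T by simp
    ultimately have fe: "mirrored e = e" by blast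
    then have r: "flip_result T d e = insert e (T - {d})"
      using fd by (auto simp: flip_result_def sym_orbit_mirrored)
    have "mirrored g \<in> insert e (T - {d})" if "g \<in> insert e (T - {d})" for g
      using that fe fd T mirrored_eq_iff[of g d] by auto
    then show ?thesis
      using r F(4) fe True central_iff_fixed[OF F(8)] by (auto simp: cs_triangulations_iff)
  next
    case False
    obtain u where u: "u \<in> V" "closed_segment u (mirror u) \<in> T"
      using cs_central_diagonalE[OF T] .
    define c where "c = closed_segment u (mirror u)"
    have c: "c \<in> T" "central z c" "c \<noteq> d"
      using u central_iff[of u "mirror u"] False by (auto simp: c_def)
    then have cK: "c \<in> diagonals K" using F(1) triangulation_diagonal by blast
    have ce: "\<not> crossing c e" using c(1,3) triangulation_not_crossing[OF F(4)] by blast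
    have cd: "\<not> crossing c d" using c(1) F(2) triangulation_not_crossing[OF F(1)] by blast
    have "\<not> central z e" using central_crossing[OF cK F(8) c(2)] ce c(1) F(5) by blast
    let ?T = "insert e (T - {d})"
    have T': "triangulation K (mirrored ` ?T)" using mirrored_triangulation[OF F(4)] .
    note img = mirrored_image_flip[OF T, of e d]
    define R where "R = flip_result T d e"
    have R: "R = insert e (insert (mirrored e) (T - {d, mirrored d}))"
      by (auto simp: R_def flip_result_def sym_orbit_mirrored)
    have "triangulation K R"
    proof (rule triangulationI)
      show "R \<subseteq> diagonals K"
        using F mirrored_diagonal triangulation_diagonal[OF F(1)] by (auto simp: R)
      have e: "\<not> crossing e h" if "h \<in> R" for h
        using that triangulation_not_crossing[OF F(4), of e h] not_crossing_mirrored[OF F(8)]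
        by (auto simp: R)
      have e': "\<not> crossing (mirrored e) h" if "h \<in> R" for h
        using that triangulation_not_crossing[OF T'[unfolded img], of "mirrored e" h]
          not_crossing_mirrored[OF F(8)] crossing_sym by (auto simp: R)
      show "\<not> crossing g h" if "g \<in> R" "h \<in> R" for g h
        using that e[of g] e[of h] e'[of g] e'[of h] crossing_sym[of g h]
          triangulation_not_crossing[OF F(1), of g h] by (auto simp: R)
      show "f \<in> R" if f: "f \<in> diagonals K" "\<And>g. g \<in> R \<Longrightarrow> \<not> crossing f g" for f
      proof -
        have "crossing f c"
          if "crossing f d" "crossing f (mirrored d)"
          using crossing_both_sides[OF u(1) F(7) _ F(7) _ _ f(1) that] cd by (simp add: c_def)
        moreover have "mirrored d \<noteq> c" using c False central_iff_fixed[OF F(7)]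
            central_iff_fixed[OF cK] by (metis mirrored_mirrored)
        then have "c \<in> R" using c(1,3) by (auto simp: R)
        ultimately consider "\<not> crossing f d" | "\<not> crossing f (mirrored d)" using f(2) by blast
        then show ?thesis
        proof cases
          case 1
          then have "f \<in> insert (mirrored e) (T - {mirrored d})"
            using triangulation_maximal[OF T'[unfolded img] f(1)] f(2) 1 by (auto simp: R)
          moreover have "f \<noteq> d" using f(2)[of e] F(6) by (auto simp: R)
          ultimately show ?thesis by (auto simp: R)
        next
          case 2
          then have "f \<in> insert e (T - {d})"
            using triangulation_maximal[OF F(4) f(1)] f(2) 2 by (auto simp: R)
          moreover have "f \<noteq> mirrored d"
            using f(2)[of "mirrored e"] F(6) mirrored_crossing[OF F(7,8)] by (auto simp: R)
          ultimately show ?thesis by (auto simp: R)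
        qed
      qed
    qed
    moreover have "mirrored g \<in> R" if gR: "g \<in> R" for g
    proof -
      consider "g = e" | "g = mirrored e" | "g \<in> T" "g \<noteq> d" "g \<noteq> mirrored d"
        using gR by (auto simp: R)
      then show ?thesis
      proof cases
        case 3
        then have "mirrored g \<noteq> d" by (metis mirrored_mirrored)
        then show ?thesis using 3 T by (simp add: R)
      qed (simp_all add: R)
    qed
    ultimately show ?thesis
      using \<open>\<not> central z e\<close> False by (auto simp: cs_triangulations_iff R_def)
  qed
  then show "flip_result T d e \<in> cs_triangulations K z" "central z e \<longleftrightarrow> central z d" by blast+
qed

lemma flip_ex:
  assumes "triangulation K T" "d \<in> T"
  shows "\<exists>e. flips_to K T d e"
proof -
  obtain a b where ab: "a \<in> V" "b \<in> V" "a \<noteq> b" "d = closed_segment a b" "link T a b"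
    using triangulation_segE[OF assms] .
  have "d \<in> diagonals K" using assms triangulation_diagonal by blast
  then have "side a b \<noteq> {}" "side b a \<noteq> {}"
    unfolding ab(4) using diagonal_iff[OF ab(1-3)] by simp_all
  then obtain x0 y0 where "L a b x0" "L b a y0"
    by (auto simp: side_def)
  then obtain x y where x: "L a b x" "link T a x" "link T x b"
    and y: "L b a y" "link T b y" "link T y a"
    using triangle[OF assms(1) ab(5)] triangle[OF assms(1) link_sym[OF ab(5)]] by metis
  then have "flips_to K T d (closed_segment x y)"
    using flip_exists(1)[OF assms(1) _ x(1) y(1) x(2,3) link_sym[OF y(3)] link_sym[OF y(2)]]
      assms(2) ab(4) by blast
  then show ?thesis by blast
qed

section \<open>Counting and connectedness\<close>

definition closed_side :: "point \<Rightarrow> point \<Rightarrow> point set" where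
  "closed_side a b = insert a (insert b (side a b))"

text \<open>The closed side makes \<open>a b\<close> itself count when it is in \<open>T\<close>,
  which turns the count into exactly the number of vertices on the open side.\<close>

definition diagonals_left :: "point set set \<Rightarrow> point \<Rightarrow> point \<Rightarrow> point set set" where
  "diagonals_left T a b = {d \<in> T. \<exists>p \<in> closed_side a b. \<exists>q \<in> closed_side a b. d = closed_segment p q}"

lemma side_split:
  assumes "L a b x"
  shows "side a b = insert x (side a x \<union> side x b)"
    "x \<notin> side a x \<union> side x b" "side a x \<inter> side x b = {}"
    "closed_side a x \<inter> closed_side x b = {x}"
    "b \<notin> closed_side a x" "a \<notin> closed_side x b"
proof -
  have ax: "L a b y" if "L a x y" for y
    using L_trans[OF assms that] .
  have xb: "L a b y" if "L x b y" for y
    using L_trans[of b y x a] that assms L_cyclic by metis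
  have disj: "\<not> (L a x y \<and> L x b y)" for y
    using assms L_cyclic L_trans L_asym by metis
  have cover: "y = x \<or> L a x y \<or> L x b y" if "L a b y" for y
  proof (rule ccontr)
    assume n: "\<not> ?thesis"
    have V: "a \<in> V" "b \<in> V" "x \<in> V" "y \<in> V" "a \<noteq> x" "a \<noteq> y" "b \<noteq> x" "b \<noteq> y"
      using assms that L_V L_distinct by blast+
    then have "L x a y" "L b x y" using n L_total[of a x y] L_total[of x b y] by blast+
    then show False using that assms L_cyclic L_trans L_asym by metis
  qed
  show "side a b = insert x (side a x \<union> side x b)"
    using ax xb cover assms unfolding side_def by blast
  show "x \<notin> side a x \<union> side x b" by (simp add: side_def)
  show "side a x \<inter> side x b = {}" using disj by (auto simp: side_def)
  have ne: "a \<noteq> b" "a \<noteq> x" "b \<noteq> x" using L_distinct[OF assms] by auto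
  have na: "\<not> L x b a" using assms L_asym L_cyclic by metis
  have nb: "\<not> L a x b" using assms L_asym L_cyclic by metis
  show "b \<notin> closed_side a x" "a \<notin> closed_side x b"
    using ne na nb by (auto simp: closed_side_def side_def)
  show "closed_side a x \<inter> closed_side x b = {x}"
    using ne na nb disj by (auto simp: closed_side_def side_def)
qed

text \<open>The triangle \<open>a b x\<close> splits the region. A member of \<open>T\<close> with
  ends in both parts crosses \<open>a x\<close> or \<open>x b\<close>, unless it ends in
  \<open>x\<close> or is \<open>a b\<close>.\<close>

lemma diagonals_left_split:
  assumes T: "triangulation K T" and ab: "closed_segment a b \<in> T"
    and x: "L a b x" "link T a x" "link T x b"
  shows "diagonals_left T a b =
    insert (closed_segment a b) (diagonals_left T a x \<union> diagonals_left T x b)" (is "?l = ?r")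
    and "closed_segment a b \<notin> diagonals_left T a x \<union> diagonals_left T x b"
    and "diagonals_left T a x \<inter> diagonals_left T x b = {}"
proof -
  note split = side_split[OF x(1)]
  have cs: "closed_side a b = closed_side a x \<union> closed_side x b"
    using split(1) by (auto simp: closed_side_def)
  have ne: "a \<noteq> b" "a \<noteq> x" "b \<noteq> x" using L_distinct[OF x(1)] by auto
  show notin: "closed_segment a b \<notin> diagonals_left T a x \<union> diagonals_left T x b"
    using split(5,6) unfolding diagonals_left_def by (auto simp: doubleton_eq_iff)
  show "diagonals_left T a x \<inter> diagonals_left T x b = {}"
  proof (rule ccontr)
    assume "\<not> ?thesis"
    then obtain d where d: "d \<in> diagonals_left T a x" "d \<in> diagonals_left T x b" by blast
    obtain p q where pq: "d \<in> T" "p \<in> closed_side a x" "q \<in> closed_side a x" "d = closed_segment p q"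
      using d(1) by (auto simp: diagonals_left_def)
    obtain r s where rs: "r \<in> closed_side x b" "s \<in> closed_side x b" "d = closed_segment r s"
      using d(2) by (auto simp: diagonals_left_def)
    have "p \<in> closed_side a x \<inter> closed_side x b" "q \<in> closed_side a x \<inter> closed_side x b"
      using pq rs by (auto simp: doubleton_eq_iff)
    then have "p = x" "q = x" unfolding split(4) by auto
    then have "d = {x}" using pq by simp
    moreover obtain v w where "v \<noteq> w" "d = closed_segment v w"
      using triangulation_segE[OF T pq(1)] by metis
    ultimately show False by (metis closed_segment_eq_sing)
  qed
  have mixed: "closed_segment p q \<in> ?r"
    if pq: "p \<in> closed_side a x" "q \<in> closed_side x b" "closed_segment p q \<in> T" for p q
  proof (cases "p = x \<or> q = x \<or> p = a \<and> q = b")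
    case True
    moreover have "x \<in> closed_side a x" "x \<in> closed_side x b" by (auto simp: closed_side_def)
    ultimately show ?thesis using pq by (auto simp: diagonals_left_def)
  next
    case False
    have "p \<noteq> q" using False split(4) pq by blast
    have V: "p \<in> V" "q \<in> V" using pq x L_V by (auto simp: closed_side_def side_def link_def)
    then have l: "link T p q" using pq \<open>p \<noteq> q\<close> by (simp add: link_def)
    show ?thesis
    proof (cases "p = a")
      case True
      then have "L x b q" using False pq(2) by (auto simp: closed_side_def side_def)
      moreover have "L b x p" using x(1) True L_cyclic by metis
      ultimately show ?thesis using link_not_cross[OF T x(3) link_sym[OF l]] by blast
    next
      case False
      then have "L a x p" using \<open>\<not> (p = x \<or> q = x \<or> p = a \<and> q = b)\<close> pq(1)
        by (auto simp: closed_side_def side_def)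
      moreover have "L x a q"
      proof (cases "q = b")
        case True
        then show ?thesis using x(1) L_cyclic by metis
      next
        case False
        then have "L x b q" using \<open>\<not> (p = x \<or> q = x \<or> p = a \<and> q = b)\<close> pq(2)
          by (auto simp: closed_side_def side_def)
        moreover have "L x a b" using x(1) L_cyclic by metis
        ultimately show ?thesis using L_trans by blast
      qed
      ultimately show ?thesis using link_not_cross[OF T x(2) l] by blast
    qed
  qed
  have "?l \<subseteq> ?r"
  proof
    fix d assume "d \<in> ?l"
    then obtain p q where pq: "p \<in> closed_side a b" "q \<in> closed_side a b" "d \<in> T" "d = closed_segment p q"
      unfolding diagonals_left_def by blast
    from pq(1,2)[unfolded cs] consider "p \<in> closed_side a x" "q \<in> closed_side a x"
      | "p \<in> closed_side x b" "q \<in> closed_side x b" | "p \<in> closed_side a x" "q \<in> closed_side x b"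
      | "q \<in> closed_side a x" "p \<in> closed_side x b" by blast
    then show "d \<in> ?r"
    proof cases
      case 1
      then have "d \<in> diagonals_left T a x" using pq(3,4) unfolding diagonals_left_def by blast
      then show ?thesis by simp
    next
      case 2
      then have "d \<in> diagonals_left T x b" using pq(3,4) unfolding diagonals_left_def by blast
      then show ?thesis by simp
    next
      case 3
      then show ?thesis using mixed pq(3,4) by simp
    next
      case 4
      then show ?thesis using mixed[of q p] pq(3,4) by (simp add: closed_segment_commute[of q p])
    qed
  qed
  moreover have "?r \<subseteq> ?l"
  proof -
    have "diagonals_left T a x \<subseteq> ?l" "diagonals_left T x b \<subseteq> ?l"
      unfolding diagonals_left_def cs by blast+
    moreover have "closed_segment a b \<in> ?l"
      using ab unfolding diagonals_left_def closed_side_def by blast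
    ultimately show ?thesis by simp
  qed
  ultimately show "?l = ?r" by (rule subset_antisym)
qed

text \<open>With \<open>k > 0\<close> vertices on its left, \<open>a b\<close> cuts off a polygon
  with \<open>k + 2\<close> vertices, which has \<open>k - 1\<close> inner diagonals;
  \<open>a b\<close> is the \<open>k\<close>-th. The vertex \<open>y\<close> on the other side
  ensures that \<open>a b\<close> is not a boundary edge in this case.\<close>

lemma card_diagonals_left:
  assumes T: "triangulation K T"
  shows "link T a b \<Longrightarrow> L b a y \<Longrightarrow> card (diagonals_left T a b) = card (side a b)"
proof (induction "card (side a b)" arbitrary: a b y rule: less_induct)
  case less
  have V: "a \<in> V" "b \<in> V" "a \<noteq> b" using less.prems by (auto simp: link_def)
  show ?case
  proof (cases "side a b = {}")
    case True
    have "diagonals_left T a b = {}"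
    proof (rule ccontr)
      assume "\<not> ?thesis"
      then obtain p q where pq: "closed_segment p q \<in> T" "p \<in> {a, b}" "q \<in> {a, b}"
        unfolding diagonals_left_def closed_side_def True by blast
      obtain v w where "v \<noteq> w" "closed_segment p q = closed_segment v w"
        using triangulation_segE[OF T pq(1)] by metis
      then have "p \<noteq> q" by (metis closed_segment_eq_sing closed_segment_idem)
      then have "closed_segment a b \<in> T" using pq by (auto simp: closed_segment_commute)
      then show False using True diagonal_iff[OF V] triangulation_diagonal[OF T] by blast
    qed
    then show ?thesis using True by simp
  next
    case False
    then obtain c where c: "L a b c" by (auto simp: side_def)
    obtain x where x: "L a b x" "link T a x" "link T x b"
      using triangle[OF T less.prems(1) c] .
    have abT: "closed_segment a b \<in> T" using link_in[OF less.prems(1) c less.prems(2)] .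
    note S = side_split[OF x(1)] and D = diagonals_left_split[OF T abT x]
    have fin: "finite (diagonals_left T p q)" for p q
      using triangulation_finite[OF T] by (simp add: diagonals_left_def)
    have card_side: "card (side a b) = Suc (card (side a x) + card (side x b))"
      using S finite_side by (simp add: card_Un_disjoint)
    have "card (diagonals_left T a x) = card (side a x)"
      using less.hyps[of a x b] x L_cyclic card_side by (metis less_add_Suc1)
    moreover have "card (diagonals_left T x b) = card (side x b)"
      using less.hyps[of x b a] x L_cyclic card_side by (metis less_add_Suc1 add.commute)
    moreover have "card (diagonals_left T a b) =
        Suc (card (diagonals_left T a x) + card (diagonals_left T x b))"
      using D fin by (simp add: card_Un_disjoint)
    ultimately show ?thesis using card_side by simp
  qed
qed

text \<open>The diagonals weakly to the left of the central one, itself included, represent every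
  orbit exactly once, and \<open>n + 1\<close> vertices lie strictly to its left.\<close>

lemma cs_card_orbits:
  assumes T: "T \<in> cs_triangulations K z"
  shows "card (sym_orbit z ` T) = n + 1"
proof -
  have tri: "triangulation K T" using T cs_triangulation by blast
  obtain u where u: "u \<in> V" "closed_segment u (mirror u) \<in> T"
    using cs_central_diagonalE[OF T] .
  define c where "c = closed_segment u (mirror u)"
  have um: "u \<noteq> mirror u" using u by simp
  have cT: "c \<in> T" using u by (simp add: c_def)
  let ?A = "diagonals_left T u (mirror u)"
  have "link T u (mirror u)" using u um by (simp add: link_def)
  moreover obtain y where "L (mirror u) u y"
    using central_diagonal(2)[OF u(1)] by (auto simp: side_def)
  ultimately have card: "card ?A = n + 1"
    using card_diagonals_left[OF tri] central_sides[OF u(1)] by metis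
  have left: "x \<in> closed_side u v \<longleftrightarrow> weakly_left u v x" for x v
    by (auto simp: closed_side_def side_def weakly_left_def)
  have both: "x = u \<or> x = mirror u" if "weakly_left u (mirror u) x" "weakly_left u (mirror u) (mirror x)" for x
  proof -
    have "weakly_left (mirror u) u x" using that(2) weakly_left_mirror[of u "mirror x"] by simp
    then show ?thesis using that(1) L_asym unfolding weakly_left_def by blast
  qed
  have "inj_on (sym_orbit z) ?A"
  proof (rule inj_onI)
    fix d e assume de: "d \<in> ?A" "e \<in> ?A" "sym_orbit z d = sym_orbit z e"
    show "d = e"
    proof (rule ccontr)
      assume "d \<noteq> e"
      then have e: "e = mirrored d" using de(3) by (auto simp: sym_orbit_mirrored doubleton_eq_iff)
      obtain p q where pq: "weakly_left u (mirror u) p" "weakly_left u (mirror u) q" "d = closed_segment p q"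
        using de(1) by (auto simp: diagonals_left_def left)
      obtain r s where rs: "weakly_left u (mirror u) r" "weakly_left u (mirror u) s" "e = closed_segment r s"
        using de(2) by (auto simp: diagonals_left_def left)
      have "{mirror p, mirror q} = {r, s}"
        using e pq(3) rs(3) by (simp add: mirrored_segment)
      then have "weakly_left u (mirror u) (mirror p)" "weakly_left u (mirror u) (mirror q)"
        using rs by (auto simp: doubleton_eq_iff)
      then have "p \<in> {u, mirror u}" "q \<in> {u, mirror u}" using both pq by auto
      \<comment> \<open>\<open>diagonals_left\<close> does not ask for \<open>p \<noteq> q\<close>,
        hence the two degenerate segments, which are not diagonals.\<close>
      then have "d = c \<or> d = {u} \<or> d = {mirror u}"
        using pq(3) by (auto simp: c_def closed_segment_commute)
      moreover obtain v w where "v \<noteq> w" "d = closed_segment v w"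
        using triangulation_segE[OF tri] de(1) unfolding diagonals_left_def by (metis (no_types, lifting) mem_Collect_eq)
      ultimately have "d = c" by (metis closed_segment_eq_sing)
      then have "mirrored d = d" by (simp add: c_def mirrored_segment closed_segment_commute)
      then show False using e \<open>d \<noteq> e\<close> by simp
    qed
  qed
  moreover have "sym_orbit z ` ?A = sym_orbit z ` T"
  proof (intro equalityI subsetI)
    fix O' assume "O' \<in> sym_orbit z ` T"
    then obtain d where d: "d \<in> T" "O' = sym_orbit z d" by blast
    obtain a b where ab: "a \<in> V" "b \<in> V" "a \<noteq> b" "d = closed_segment a b"
      using triangulation_segE[OF tri d(1)] by metis
    have "\<not> crossing c d" using triangulation_not_crossing[OF tri cT d(1)] .
    then consider "weakly_left u (mirror u) a" "weakly_left u (mirror u) b"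
      | "weakly_left (mirror u) u a" "weakly_left (mirror u) u b"
      using weakly_left_sides[of u "mirror u" a b] u ab um by (auto simp: c_def)
    then show "O' \<in> sym_orbit z ` ?A"
    proof cases
      case 1
      then have "d \<in> ?A" using d(1) ab(4) left by (auto simp: diagonals_left_def)
      then show ?thesis using d(2) by blast
    next
      case 2
      then have "weakly_left u (mirror u) (mirror a)" "weakly_left u (mirror u) (mirror b)"
        using weakly_left_mirror[of "mirror u"] by simp_all
      then have "mirrored d \<in> ?A"
        using d(1) ab(4) left T by (auto simp: diagonals_left_def mirrored_segment[symmetric]) (auto simp: mirrored_segment)
      moreover have "sym_orbit z (mirrored d) = O'" using d(2) by (auto simp: sym_orbit_mirrored)
      ultimately show ?thesis by blast
    qed
  qed (auto simp: diagonals_left_def)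
  ultimately show ?thesis using card card_image by metis
qed

section \<open>Connectedness by symmetric flips\<close>

text \<open>Flips of diagonals of the target are forbidden. So what is already shared with the
  target stays, and in the colored setting all labels used will lie in the prescribed set.\<close>

definition flip_steps :: "point set set \<Rightarrow> (point set set \<times> point set set) set" where
  "flip_steps T' = {(T, T2). T \<in> cs_triangulations K z \<and> T2 \<in> cs_triangulations K z \<and>
     (\<exists>d e. d \<notin> T' \<and> flips_to K T d e \<and> T2 = flip_result T d e)}"

lemma flip_towards_diagonal:
  assumes T: "T \<in> cs_triangulations K z" and T': "T' \<in> cs_triangulations K z"
    and p: "p \<in> T'" "central z p \<or> (\<exists>c \<in> T \<inter> T'. central z c)"
  shows "\<exists>T2. (T, T2) \<in> (flip_steps T')\<^sup>* \<and> T2 \<in> cs_triangulations K z \<and> p \<in> T2 \<and> T \<inter> T' \<subseteq> T2"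
  using T p(2)
proof (induction "card {g \<in> T. crossing p g}" arbitrary: T rule: less_induct)
  case less
  note T = less.prems(1)
  have tri: "triangulation K T" "triangulation K T'" using T T' cs_triangulation by blast+
  show ?case
  proof (cases "p \<in> T")
    case True
    then show ?thesis using T by blast
  next
    case False
    have pK: "p \<in> diagonals K" using triangulation_diagonal[OF tri(2) p(1)] .
    obtain u w where uw: "u \<in> V" "w \<in> V" "u \<noteq> w" "p = closed_segment u w"
      using diagonalE[OF pK] .
    then have "\<not> link T u w"
      using False pK diagonal_iff[OF uw(1-3)] by (auto simp: link_def)
    then obtain d y where d: "d \<in> T" "crossing p d" and y: "y \<in> V" "y \<noteq> u"
      and flip: "flips_to K T d (closed_segment u y)"
      using flip_towards[OF tri(1) uw(1-3)] uw(4) by metis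
    define e where "e = closed_segment u y"
    have flip: "flips_to K T d e" using flip by (simp add: e_def)
    note F = flips_to_facts[OF flip]
    define T2 where "T2 = flip_result T d e"
    \<comment> \<open>Since \<open>d\<close> crosses \<open>p\<close>, it is not in the target, so
      its flip is allowed.\<close>
    have dT': "d \<notin> T'" using triangulation_not_crossing[OF tri(2) p(1)] d(2) by blast
    have T2: "T2 \<in> cs_triangulations K z" using symmetric_flip[OF T flip] by (simp add: T2_def)
    have step: "(T, T2) \<in> flip_steps T'"
      using T T2 dT' flip by (auto simp: flip_steps_def T2_def)
    have "mirrored d \<notin> T'" using dT' T' by simp
    then have keep: "T \<inter> T' \<subseteq> T2"
      using dT' by (auto simp: T2_def flip_result_def sym_orbit_mirrored)
    have pe: "\<not> crossing p e"
      unfolding uw(4) e_def using crossing_iff[OF uw(1-3) uw(1) y(1)] y(2) by auto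
    have pe': "\<not> crossing p (mirrored e)"
    proof (cases "central z p")
      case True
      then have "w = mirror u" using central_iff uw by blast
      then show ?thesis
        unfolding uw(4) e_def mirrored_segment
        using crossing_iff[OF uw(1-3), of "mirror u" "mirror y"] uw y by auto
    next
      case False
      then obtain c where c: "c \<in> T" "c \<in> T'" "central z c" using less.prems(2) by blast
      have cK: "c \<in> diagonals K" using triangulation_diagonal[OF tri(1) c(1)] .
      obtain v where v: "v \<in> V" "c = closed_segment v (mirror v)"
        using centralE[OF cK c(3)] .
      have "c \<noteq> d" using c dT' by blast
      then have ce: "\<not> crossing c e" using c(1) triangulation_not_crossing[OF F(4)] by blast
      have cd: "\<not> crossing c d" using triangulation_not_crossing[OF tri(1) c(1) d(1)] .
      have "\<not> crossing p c" using triangulation_not_crossing[OF tri(2) p(1) c(2)] .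
      then show ?thesis
        using crossing_both_sides[OF v(1) F(7) _ F(8) _ _ pK d(2)] cd ce F(6) v(2) by blast
    qed
    have "{g \<in> T2. crossing p g} \<subset> {g \<in> T. crossing p g}"
    proof
      show "{g \<in> T2. crossing p g} \<subseteq> {g \<in> T. crossing p g}"
        using pe pe' by (auto simp: T2_def flip_result_def sym_orbit_mirrored)
      have "d \<notin> T2" using F(5,2) T pe pe' d(2) by (auto simp: T2_def flip_result_def sym_orbit_mirrored)
      then show "{g \<in> T2. crossing p g} \<noteq> {g \<in> T. crossing p g}" using d by blast
    qed
    then have "card {g \<in> T2. crossing p g} < card {g \<in> T. crossing p g}"
      using triangulation_finite[OF tri(1)] by (intro psubset_card_mono) auto
    moreover have "central z p \<or> (\<exists>c \<in> T2 \<inter> T'. central z c)"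
      using less.prems(2) keep by blast
    ultimately obtain T3 where "(T2, T3) \<in> (flip_steps T')\<^sup>*" "T3 \<in> cs_triangulations K z" "p \<in> T3" "T2 \<inter> T' \<subseteq> T3"
      using less.hyps[OF _ T2] by blast
    then show ?thesis
      using step keep by (intro exI[of _ T3]) (auto intro: converse_rtrancl_into_rtrancl)
  qed
qed

text \<open>Producing a diagonal loses none of those shared with the target, so the number of
  missing ones decreases. In particular, the central diagonal remains common once it has been
  produced.\<close>

lemma flip_connected:
  assumes T: "T \<in> cs_triangulations K z" and T': "T' \<in> cs_triangulations K z"
  shows "(T, T') \<in> (flip_steps T')\<^sup>*"
proof -
  have *: "(T, T') \<in> (flip_steps T')\<^sup>*"
    if "T \<in> cs_triangulations K z" "\<exists>c \<in> T \<inter> T'. central z c" for T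
    using that
  proof (induction "card (T' - T)" arbitrary: T rule: less_induct)
    case less
    have tri: "triangulation K T" "triangulation K T'" using less.prems T' cs_triangulation by blast+
    show ?case
    proof (cases "T' \<subseteq> T")
      case True
      then show ?thesis using triangulation_subset_eq[OF tri(2,1)] by simp
    next
      case False
      then obtain p where p: "p \<in> T'" "p \<notin> T" by blast
      obtain T2 where T2: "(T, T2) \<in> (flip_steps T')\<^sup>*" "T2 \<in> cs_triangulations K z" "p \<in> T2" "T \<inter> T' \<subseteq> T2"
        using flip_towards_diagonal[OF less.prems(1) T' p(1) disjI2[OF less.prems(2)]] by blast
      have "T' - T2 \<subset> T' - T" using T2 p by blast
      then have "card (T' - T2) < card (T' - T)"
        using triangulation_finite[OF tri(2)] by (intro psubset_card_mono) auto
      then have "(T2, T') \<in> (flip_steps T')\<^sup>*"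
        using less.hyps[OF _ T2(2)] less.prems(2) T2(4) by blast
      then show ?thesis using T2(1) by simp
    qed
  qed
  obtain c where c: "c \<in> T'" "central z c" using cs_central_exists[OF T'] by blast
  obtain T2 where T2: "(T, T2) \<in> (flip_steps T')\<^sup>*" "T2 \<in> cs_triangulations K z" "c \<in> T2"
    using flip_towards_diagonal[OF T T' c(1)] c(2) by blast
  then have "(T2, T') \<in> (flip_steps T')\<^sup>*" using * c by blast
  then show ?thesis using T2(1) by simp
qed

end

section \<open>Colorings\<close>

text \<open>Both images correspond to the classes of one and the same partition of \<open>A\<close>.
  This is applied to the labels and the orbits of a triangulation.\<close>

lemma card_image_same_kernel:
  assumes "\<And>x y. x \<in> A \<Longrightarrow> y \<in> A \<Longrightarrow> f x = f y \<longleftrightarrow> g x = g y"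
  shows "card (f ` A) = card (g ` A)"
proof (rule bij_betw_same_card)
  show "bij_betw (\<lambda>y. g (inv_into A f y)) (f ` A) (g ` A)"
  proof (rule bij_betwI')
    fix x y assume "x \<in> f ` A" "y \<in> f ` A"
    then show "g (inv_into A f x) = g (inv_into A f y) \<longleftrightarrow> x = y"
      using assms[of "inv_into A f x" "inv_into A f y"]
      by (simp add: inv_into_into f_inv_into_f)
  next
    fix x assume "x \<in> f ` A"
    then show "g (inv_into A f x) \<in> g ` A" by (simp add: inv_into_into)
  next
    fix y assume "y \<in> g ` A"
    then obtain a where a: "a \<in> A" "y = g a" by blast
    then have "g (inv_into A f (f a)) = g a"
      using assms[of "inv_into A f (f a)" a] by (simp add: inv_into_into f_inv_into_f)
    then show "\<exists>x\<in>f ` A. y = g (inv_into A f x)" using a by (intro bexI[of _ "f a"]) auto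
  qed
qed

locale colored_polygon = symmetric_polygon n K z
  for n :: nat and K :: "point set" and z :: point +
  fixes CK :: "'c set"
  assumes finite_colors: "finite CK" and card_colors: "card CK = n"
begin

section \<open>Labels of colored triangulations\<close>

abbreviation "cs \<equiv> cs_triangulations K z"
abbreviation "\<C> \<equiv> colored_triangulations K z CK"
abbreviation "labels \<equiv> extended_colors CK"

lemma central_mirrored: "d \<in> diagonals K \<Longrightarrow> central z (mirrored d) \<longleftrightarrow> central z d"
  by (metis central_iff_fixed mirrored_diagonal mirrored_mirrored)

lemma sym_orbit_eq_iff: "sym_orbit z d = sym_orbit z e \<longleftrightarrow> e = d \<or> e = mirrored d"
  by (auto simp: sym_orbit_mirrored doubleton_eq_iff)

lemma mem_sym_orbit: "x \<in> sym_orbit z d \<longleftrightarrow> sym_orbit z x = sym_orbit z d"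
  unfolding sym_orbit_eq_iff by (auto simp: sym_orbit_mirrored)

lemma cs_sym_orbit: "T \<in> cs \<Longrightarrow> d \<in> T \<Longrightarrow> sym_orbit z d \<subseteq> T"
  by (simp add: sym_orbit_mirrored)

lemma cs_diagonal: "T \<in> cs \<Longrightarrow> d \<in> T \<Longrightarrow> d \<in> diagonals K"
  using cs_triangulation triangulation_diagonal by blast

lemma central_cong:
  assumes "T \<in> cs" "d \<in> T" "sym_orbit z d = sym_orbit z e"
  shows "central z d \<longleftrightarrow> central z e"
  using assms central_mirrored cs_diagonal unfolding sym_orbit_eq_iff by blast

text \<open>The definition compares only colors of non-central diagonals. As the central diagonal is
  unique and alone has the value \<open>None\<close> in \<open>T\<close>, the comparison extends to
  all of \<open>T\<close>, which treats the extra label like a color.\<close>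

lemma colored_iff:
  "(T, \<kappa>) \<in> \<C> \<longleftrightarrow> T \<in> cs \<and> dom \<kappa> = {d \<in> T. \<not> central z d} \<and> ran \<kappa> \<subseteq> CK \<and>
     (\<forall>d\<in>T. \<forall>e\<in>T. \<kappa> d = \<kappa> e \<longleftrightarrow> sym_orbit z d = sym_orbit z e)"
proof (cases "T \<in> cs \<and> dom \<kappa> = {d \<in> T. \<not> central z d}")
  case False
  then show ?thesis by (auto simp: colored_triangulations_def)
next
  case True
  then have T: "T \<in> cs" and dom: "\<And>d. d \<in> dom \<kappa> \<longleftrightarrow> d \<in> T \<and> \<not> central z d" by blast+
  have "(\<forall>d\<in>T. \<forall>e\<in>T. \<kappa> d = \<kappa> e \<longleftrightarrow> sym_orbit z d = sym_orbit z e)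
      \<longleftrightarrow> (\<forall>d\<in>dom \<kappa>. \<forall>e\<in>dom \<kappa>. \<kappa> d = \<kappa> e \<longleftrightarrow> sym_orbit z d = sym_orbit z e)" (is "?l \<longleftrightarrow> ?r")
  proof
    assume r: ?r
    show ?l
    proof (intro ballI)
      fix d e assume de: "d \<in> T" "e \<in> T"
      show "\<kappa> d = \<kappa> e \<longleftrightarrow> sym_orbit z d = sym_orbit z e"
      proof (cases "central z d \<or> central z e")
        case True
        then have "\<kappa> d = None \<or> \<kappa> e = None" using dom[of d] dom[of e] by (auto simp: dom_def)
        then have "\<kappa> d = \<kappa> e \<longleftrightarrow> central z d \<and> central z e"
          using dom[of d] dom[of e] de True by (auto simp: dom_def)
        moreover have "central z d \<and> central z e \<longrightarrow> d = e"
          using cs_central_unique[OF T] de by blast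
        ultimately show ?thesis using central_cong[OF T de(1), of e] True by blast
      next
        case False
        then have "d \<in> dom \<kappa>" "e \<in> dom \<kappa>" using dom de by simp_all
        then show ?thesis using r by simp
      qed
    qed
  qed (use dom in blast)
  then show ?thesis using True by (auto simp: colored_triangulations_def)
qed

lemma coloredD:
  assumes "t \<in> \<C>"
  shows "fst t \<in> cs" "dom (snd t) = {d \<in> fst t. \<not> central z d}" "ran (snd t) \<subseteq> CK"
    "\<And>d e. d \<in> fst t \<Longrightarrow> e \<in> fst t \<Longrightarrow> snd t d = snd t e \<longleftrightarrow> sym_orbit z d = sym_orbit z e"
  using assms colored_iff[of "fst t" "snd t"] by auto

lemma finite_labels: "finite labels" and card_labels: "card labels = n + 1"
  using finite_colors card_colors
  by (simp_all add: extended_colors_def card_image)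

text \<open>A coloring separates the \<open>n + 1\<close> orbits, and there are only
  \<open>n + 1\<close> labels.\<close>

lemma colored_labels:
  assumes t: "t \<in> \<C>"
  shows "snd t ` fst t = labels"
proof (rule card_subset_eq[OF finite_labels])
  note D = coloredD[OF t]
  show "snd t ` fst t \<subseteq> labels"
  proof
    fix l assume "l \<in> snd t ` fst t"
    then obtain d where "l = snd t d" by blast
    then show "l \<in> labels"
    proof (cases l)
      case (Some a)
      then have "a \<in> CK" using D(3) ranI[of "snd t" d a] \<open>l = snd t d\<close> by auto
      then show ?thesis using Some by (simp add: extended_colors_def)
    qed (simp add: extended_colors_def)
  qed
  show "card (snd t ` fst t) = card labels"
    using card_image_same_kernel[of "fst t" "snd t" "sym_orbit z"] D(4)
      cs_card_orbits[OF D(1)] card_labels by simp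
qed

text \<open>Without the central orbit there remain \<open>n\<close> orbits for \<open>n\<close>
  colors, and any bijection will do.\<close>

lemma coloring_exists:
  assumes T: "T \<in> cs"
  shows "\<exists>\<kappa>. (T, \<kappa>) \<in> \<C>"
proof -
  let ?N = "{d \<in> T. \<not> central z d}"
  obtain c where c: "c \<in> T" "central z c" using cs_central_exists[OF T] by blast
  have "T = insert c ?N" using c cs_central_unique[OF T] by blast
  then have "sym_orbit z ` T = insert (sym_orbit z c) (sym_orbit z ` ?N)" by (metis image_insert)
  moreover have "sym_orbit z c \<notin> sym_orbit z ` ?N"
    using central_cong[OF T c(1)] c(2) by blast
  moreover have fin: "finite (sym_orbit z ` ?N)"
    using triangulation_finite[OF cs_triangulation[OF T]] by simp
  ultimately have "card (sym_orbit z ` ?N) = n" using cs_card_orbits[OF T] by simp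
  then obtain h where h: "bij_betw h (sym_orbit z ` ?N) CK"
    using finite_same_card_bij[OF fin finite_colors] card_colors by auto
  define \<kappa> where "\<kappa> d = (if d \<in> ?N then Some (h (sym_orbit z d)) else None)" for d
  have "dom \<kappa> = ?N" by (auto simp: \<kappa>_def dom_def)
  moreover have "ran \<kappa> \<subseteq> CK"
    using h by (auto simp: \<kappa>_def ran_def bij_betw_def split: if_splits)
  moreover have "\<kappa> d = \<kappa> e \<longleftrightarrow> sym_orbit z d = sym_orbit z e" if "d \<in> ?N" "e \<in> ?N" for d e
    using that h inj_on_eq_iff[of h "sym_orbit z ` ?N" "sym_orbit z d" "sym_orbit z e"]
    by (auto simp: \<kappa>_def bij_betw_def)
  ultimately have "(T, \<kappa>) \<in> \<C>" using T by (simp add: colored_triangulations_def)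
  then show ?thesis by blast
qed

section \<open>Colored flips\<close>

lemma flip_result_disjoint:
  assumes "T \<in> cs" "flips_to K T d e"
  shows "sym_orbit z e \<inter> T = {}" "sym_orbit z d \<subseteq> T"
  using assms flips_to_facts[OF assms(2)] by (auto simp: sym_orbit_mirrored)

lemma colored_flip_iff:
  "colored_flip K z l t t' \<longleftrightarrow> (\<exists>d e. flips_to K (fst t) d e \<and> snd t d = l \<and>
     fst t' = flip_result (fst t) d e \<and> snd t' e = l \<and>
     (\<forall>x \<in> fst t - sym_orbit z d. snd t' x = snd t x))"
  by (simp add: colored_flip_def flip_result_def)

text \<open>The new orbit inherits the label of the old one. It is disjoint from \<open>T\<close>,
  so orbits remain separated by labels, and it is central exactly if the old one was, so
  \<open>None\<close> stays in its place.\<close>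

lemma colored_flip_exists:
  assumes t: "t \<in> \<C>" and flip: "flips_to K (fst t) d e"
  shows "\<exists>t'\<in>\<C>. fst t' = flip_result (fst t) d e \<and> colored_flip K z (snd t d) t t'"
proof -
  note D = coloredD[OF t] and F = flips_to_facts[OF flip]
  define T where "T = fst t"
  define \<kappa> where "\<kappa> = snd t"
  define T2 where "T2 = flip_result T d e"
  \<comment> \<open>\<open>None\<close> is also the value off the triangulation; the removed orbit
    of \<open>d\<close> must lose its color.\<close>
  define \<kappa>2 where "\<kappa>2 x = (if x \<in> sym_orbit z e then \<kappa> d else if x \<in> T2 then \<kappa> x else None)" for x
  note D = D[folded T_def \<kappa>_def] and F = F[folded T_def] and flip = flip[folded T_def]
  have T2: "T2 \<in> cs" and central: "central z e \<longleftrightarrow> central z d"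
    using symmetric_flip[OF D(1) flip] by (auto simp: T2_def)
  note disj = flip_result_disjoint[OF D(1) flip]
  have split: "x \<in> T2 \<longleftrightarrow> x \<in> sym_orbit z e \<or> x \<in> T \<and> x \<notin> sym_orbit z d" for x
    by (auto simp: T2_def flip_result_def)
  have new: "\<kappa>2 x = \<kappa> d" if "x \<in> sym_orbit z e" for x
    using that by (simp add: \<kappa>2_def)
  have old: "\<kappa>2 x = \<kappa> x" if "x \<in> T" "x \<notin> sym_orbit z d" for x
    using that disj split by (auto simp: \<kappa>2_def)
  have none: "\<kappa> x = None \<longleftrightarrow> central z x" if "x \<in> T" for x
  proof -
    have "x \<in> dom \<kappa> \<longleftrightarrow> \<not> central z x" using D(2) that by simp
    then show ?thesis unfolding domIff by blast
  qed
  have cen: "central z x \<longleftrightarrow> central z d" if "x \<in> sym_orbit z e" for x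
    using that central central_mirrored[OF F(8)] by (auto simp: sym_orbit_mirrored)
  have dom: "\<kappa>2 x = None \<longleftrightarrow> central z x" if "x \<in> T2" for x
    using that[unfolded split] new[of x] old[of x] none[of x] none[OF F(2)] cen[of x] by auto
  have "x \<in> dom \<kappa>2 \<longleftrightarrow> x \<in> T2 \<and> \<not> central z x" for x
  proof (cases "x \<in> T2")
    case True
    then show ?thesis using dom[OF True] by (simp add: domIff del: not_None_eq)
  next
    case False
    then have "x \<notin> sym_orbit z e" using split by blast
    then have "\<kappa>2 x = None" using False by (simp add: \<kappa>2_def)
    then show ?thesis using False by (simp add: domIff)
  qed
  then have "dom \<kappa>2 = {x \<in> T2. \<not> central z x}"
    by (simp add: set_eq_iff)
  moreover have "ran \<kappa>2 \<subseteq> CK"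
    using D(3) by (auto simp: ran_def \<kappa>2_def split: if_splits)
  moreover have "\<kappa>2 x = \<kappa>2 y \<longleftrightarrow> sym_orbit z x = sym_orbit z y" if "x \<in> T2" "y \<in> T2" for x y
  proof -
    have mixed: "\<kappa>2 x \<noteq> \<kappa>2 y \<and> sym_orbit z x \<noteq> sym_orbit z y"
      if "x \<in> sym_orbit z e" "y \<in> T" "y \<notin> sym_orbit z d" for x y
    proof
      show "\<kappa>2 x \<noteq> \<kappa>2 y"
        using new[OF that(1)] old[OF that(2,3)] D(4)[OF F(2) that(2)] that(3) mem_sym_orbit by metis
      show "sym_orbit z x \<noteq> sym_orbit z y"
        using that disj(1) mem_sym_orbit by blast
    qed
    consider "x \<in> sym_orbit z e" "y \<in> sym_orbit z e"
      | "x \<in> sym_orbit z e" "y \<in> T" "y \<notin> sym_orbit z d"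
      | "y \<in> sym_orbit z e" "x \<in> T" "x \<notin> sym_orbit z d"
      | "x \<in> T" "x \<notin> sym_orbit z d" "y \<in> T" "y \<notin> sym_orbit z d"
      using \<open>x \<in> T2\<close> \<open>y \<in> T2\<close> unfolding split by blast
    then show ?thesis
    proof cases
      case 1
      then show ?thesis using new mem_sym_orbit by metis
    next
      case 2
      then show ?thesis using mixed by blast
    next
      case 3
      then show ?thesis using mixed by metis
    next
      case 4
      then show ?thesis using old D(4) by metis
    qed
  qed
  ultimately have S: "(T2, \<kappa>2) \<in> \<C>" using T2 by (simp add: colored_iff)
  moreover have "colored_flip K z (snd t d) t (T2, \<kappa>2)"
    unfolding colored_flip_iff
  proof (intro exI conjI ballI)
    show "flips_to K (fst t) d e" using flip by (simp add: T_def)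
    show "fst (T2, \<kappa>2) = flip_result (fst t) d e" by (simp add: T2_def T_def)
    show "snd (T2, \<kappa>2) e = snd t d" using new[of e] by (simp add: \<kappa>_def sym_orbit_mirrored)
    show "snd (T2, \<kappa>2) x = snd t x" if "x \<in> fst t - sym_orbit z d" for x
      using that old by (simp add: T_def \<kappa>_def)
  qed simp
  moreover have "fst (T2, \<kappa>2) = flip_result (fst t) d e" by (simp add: T2_def T_def)
  ultimately show ?thesis by (intro bexI conjI)
qed

text \<open>A flip of a single diagonal has to be exhibited in the symmetric result. For a
  non-central \<open>d\<close>, restoring \<open>d\<close> alone leaves the mirror image of the
  triangulation reached from \<open>T\<close> by flipping \<open>d\<close> alone.\<close>

lemma flips_to_reverse:
  assumes T: "T \<in> cs" and flip: "flips_to K T d e"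
  shows "flips_to K (flip_result T d e) e d" "flip_result (flip_result T d e) e d = T"
proof -
  note F = flips_to_facts[OF flip] and disj = flip_result_disjoint[OF T flip]
  define T2 where "T2 = flip_result T d e"
  have T2: "T2 \<in> cs" and central: "central z e \<longleftrightarrow> central z d"
    using symmetric_flip[OF T flip] by (auto simp: T2_def)
  show "flip_result (flip_result T d e) e d = T"
    using disj by (auto simp: flip_result_def)
  have "triangulation K (insert d (T2 - {e}))"
  proof (cases "central z d")
    case True
    then have "mirrored d = d" "mirrored e = e" using central central_iff_fixed F by blast+
    then have "insert d (T2 - {e}) = T"
      using F by (auto simp: T2_def flip_result_def sym_orbit_mirrored)
    then show ?thesis using F by simp
  next
    case False
    then have "mirrored d \<noteq> d" "mirrored e \<noteq> e" using central central_iff_fixed F by blast+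
    then have "insert d (T2 - {e}) = insert (mirrored e) (T - {mirrored d})"
      using F by (auto simp: T2_def flip_result_def sym_orbit_mirrored)
    then show ?thesis
      using mirrored_triangulation[OF F(4)] mirrored_image_flip[OF T] by simp
  qed
  moreover have "e \<in> T2" by (simp add: T2_def flip_result_def sym_orbit_mirrored)
  ultimately show "flips_to K (flip_result T d e) e d"
    using cs_triangulation[OF T2] F(3) by (auto simp: flips_to_def T2_def)
qed

lemma colored_flip_sym:
  assumes "t \<in> \<C>" "colored_flip K z l t t'"
  shows "colored_flip K z l t' t"
proof -
  obtain d e where de: "flips_to K (fst t) d e" "snd t d = l" "fst t' = flip_result (fst t) d e"
    "snd t' e = l" "\<forall>x \<in> fst t - sym_orbit z d. snd t' x = snd t x"
    using assms(2) unfolding colored_flip_iff by blast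
  note rev = flips_to_reverse[OF coloredD(1)[OF assms(1)] de(1)]
  have "fst t' - sym_orbit z e \<subseteq> fst t - sym_orbit z d"
    using de(3) by (auto simp: flip_result_def)
  then show ?thesis
    unfolding colored_flip_iff using de rev by (intro exI[of _ e] exI[of _ d]) auto
qed

section \<open>Flip classes as stars of fixed diagonals\<close>

definition flip_rel :: "'c option set \<Rightarrow> ('c colored \<times> 'c colored) set" where
  "flip_rel C = {(t, t') \<in> \<C> \<times> \<C>. \<exists>l\<in>C. colored_flip K z l t t'}"

abbreviation "equivalent \<equiv> flip_equiv K z CK"

lemma equivalent_iff: "(t, t') \<in> equivalent C \<longleftrightarrow> (t, t') \<in> (flip_rel C)\<^sup>* \<and> t \<in> \<C> \<and> t' \<in> \<C>"
  by (simp add: flip_equiv_def flip_rel_def Let_def)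

lemma equiv_equivalent: "equiv \<C> (equivalent C)"
proof (rule equivI)
  have "sym (flip_rel C)"
    using colored_flip_sym unfolding flip_rel_def sym_def by blast
  then have "sym ((flip_rel C)\<^sup>*)" by (rule sym_rtrancl)
  then show "sym (equivalent C)" unfolding sym_def equivalent_iff by blast
  show "trans (equivalent C)" unfolding trans_def equivalent_iff by (meson rtrancl_trans)
  show "refl_on \<C> (equivalent C)" unfolding refl_on_def equivalent_iff by blast
  show "equivalent C \<subseteq> \<C> \<times> \<C>" using equivalent_iff by auto
qed

definition fixed :: "'c option set \<Rightarrow> 'c colored \<Rightarrow> point set set" where
  "fixed C t = {d \<in> fst t. snd t d \<notin> C}"

definition star :: "point set set \<Rightarrow> point set set set" where
  "star D = {T \<in> cs. D \<subseteq> T}"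

text \<open>A flip changes only the orbit that carries its label.\<close>

lemma colored_flip_fixed:
  assumes "t \<in> \<C>" "t' \<in> \<C>" "l \<in> C" "colored_flip K z l t t'"
  shows "fixed C t \<subseteq> fixed C t'"
proof
  fix x assume x: "x \<in> fixed C t"
  obtain d e where de: "flips_to K (fst t) d e" "snd t d = l" "fst t' = flip_result (fst t) d e"
    "\<forall>x \<in> fst t - sym_orbit z d. snd t' x = snd t x"
    using assms(4) unfolding colored_flip_iff by blast
  have "x \<notin> sym_orbit z d"
    using x coloredD(4)[OF assms(1), of x d] de(1,2) assms(3) flips_to_facts(2)[OF de(1)]
    by (auto simp: fixed_def mem_sym_orbit)
  then show "x \<in> fixed C t'" using x de(3,4) by (auto simp: fixed_def flip_result_def)
qed

lemma equivalent_fixed: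
  assumes "(t, t') \<in> equivalent C"
  shows "fixed C t = fixed C t'"
proof -
  have *: "fixed C t \<subseteq> fixed C t'" if "(t, t') \<in> equivalent C" for t t'
  proof -
    have "(t, t') \<in> (flip_rel C)\<^sup>*" using that equivalent_iff by blast
    then show ?thesis
    proof (induction rule: rtrancl_induct)
      case (step t' t'')
      then show ?case using colored_flip_fixed unfolding flip_rel_def by blast
    qed simp
  qed
  have "(t', t) \<in> equivalent C" using assms equiv_equivalent[of C] by (meson equivE symE)
  then show ?thesis using * assms by blast
qed

text \<open>An uncolored path to \<open>T'\<close> is lifted flip by flip. A flipped diagonal is not
  in \<open>T'\<close>, whereas all fixed diagonals are, so its label lies in
  \<open>C\<close>.\<close>

lemma equivalent_reach:
  assumes t: "t \<in> \<C>" and T': "T' \<in> star (fixed C t)"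
  shows "\<exists>t'. (t, t') \<in> equivalent C \<and> fst t' = T'"
proof -
  have T'cs: "T' \<in> cs" and sub: "fixed C t \<subseteq> T'" using T' by (auto simp: star_def)
  have "(fst t, T') \<in> (flip_steps T')\<^sup>*" using flip_connected coloredD(1)[OF t] T'cs .
  then have "\<And>t. \<lbrakk>t \<in> \<C>; fst t = T; fixed C t \<subseteq> T'\<rbrakk> \<Longrightarrow>
      \<exists>t'\<in>\<C>. (t, t') \<in> (flip_rel C)\<^sup>* \<and> fst t' = T'" if "T = fst t" for T
    unfolding that[symmetric]
  proof (induction rule: converse_rtrancl_induct)
    case base
    then show ?case by blast
  next
    case (step T1 T2)
    obtain d e where de: "d \<notin> T'" "flips_to K T1 d e" "T2 = flip_result T1 d e"
      using step.hyps(1) by (auto simp: flip_steps_def)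
    note F = flips_to_facts[OF de(2)]
    obtain t2 where t2: "t2 \<in> \<C>" "fst t2 = T2" "colored_flip K z (snd t d) t t2"
      using colored_flip_exists[OF step.prems(1)] de step.prems(2) by blast
    have l: "snd t d \<in> C" using F(2) de(1) step.prems by (auto simp: fixed_def)
    have "fixed C t2 \<subseteq> fixed C t"
      using colored_flip_fixed[OF t2(1) step.prems(1) l colored_flip_sym[OF step.prems(1) t2(3)]] .
    then obtain t' where "t' \<in> \<C>" "(t2, t') \<in> (flip_rel C)\<^sup>*" "fst t' = T'"
      using step.IH[OF t2(1,2)] step.prems(3) by blast
    moreover have "(t, t2) \<in> flip_rel C" using t2 step.prems(1) l by (auto simp: flip_rel_def)
    ultimately show ?case by (intro bexI[of _ t']) (auto intro: converse_rtrancl_into_rtrancl)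
  qed
  from this[OF refl t refl sub] show ?thesis using t equivalent_iff by blast
qed

lemma fst_image_class:
  assumes "t \<in> \<C>"
  shows "fst ` (equivalent C `` {t}) = star (fixed C t)"
proof (intro equalityI subsetI)
  fix T assume "T \<in> fst ` (equivalent C `` {t})"
  then obtain t' where t': "(t, t') \<in> equivalent C" "T = fst t'" by blast
  then have "t' \<in> \<C>" "fixed C t = fixed C t'" using equivalent_iff equivalent_fixed by blast+
  then show "T \<in> star (fixed C t)" using t'(2) coloredD(1) by (auto simp: star_def fixed_def)
qed (use equivalent_reach[OF assms] in force)

text \<open>An inclusion of stars, and not just their equality, is treated here because the
  isomorphism has to reflect the order.\<close>

lemma star_subset:
  assumes t: "t \<in> \<C>" and sub: "star (fixed C t) \<subseteq> star D"
  shows "D \<subseteq> fixed C t"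
proof
  note cs = coloredD(1)[OF t]
  have "fst t \<in> star (fixed C t)" using cs by (auto simp: star_def fixed_def)
  then have "D \<subseteq> fst t" using sub by (auto simp: star_def)
  fix d assume d: "d \<in> D"
  then have dT: "d \<in> fst t" using \<open>D \<subseteq> fst t\<close> by blast
  show "d \<in> fixed C t"
  proof (rule ccontr)
    assume nd: "d \<notin> fixed C t"
    obtain e where e: "flips_to K (fst t) d e"
      using flip_ex[OF cs_triangulation[OF cs] dT] by blast
    have "x \<notin> sym_orbit z d" if "x \<in> fixed C t" for x
      using that nd dT coloredD(4)[OF t, of x d] by (auto simp: fixed_def mem_sym_orbit)
    then have "fixed C t \<subseteq> flip_result (fst t) d e"
      by (auto simp: fixed_def flip_result_def)
    then have "flip_result (fst t) d e \<in> star (fixed C t)"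
      using symmetric_flip(1)[OF cs e] by (simp add: star_def)
    then have "d \<in> flip_result (fst t) d e" using sub d by (auto simp: star_def)
    then show False
      using flip_result_disjoint[OF cs e] dT by (auto simp: flip_result_def sym_orbit_mirrored)
  qed
qed

section \<open>The action of the symmetric group\<close>

abbreviation "\<P> \<equiv> colorful_cyclohedron K z CK"

lemma map_option_labels:
  assumes "\<sigma> \<in> Bij CK"
  shows "inj_on (map_option \<sigma>) labels" "map_option \<sigma> ` labels = labels"
proof -
  have inj: "inj_on \<sigma> CK" and im: "\<sigma> ` CK = CK"
    using assms by (auto simp: Bij_def bij_betw_def)
  show "inj_on (map_option \<sigma>) labels"
    using inj by (auto simp: inj_on_def extended_colors_def)
  have "map_option \<sigma> ` labels = insert None (Some ` \<sigma> ` CK)"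
    by (simp add: extended_colors_def image_image)
  then show "map_option \<sigma> ` labels = labels" by (simp add: im extended_colors_def)
qed

lemma fst_recolor [simp]: "fst (recolor \<sigma> t) = fst t"
  and snd_recolor: "snd (recolor \<sigma> t) d = map_option \<sigma> (snd t d)"
  by (simp_all add: recolor_def)

lemma colored_label: "t \<in> \<C> \<Longrightarrow> snd t d \<in> labels"
  using coloredD(3)[of t] ranI[of "snd t" d] by (cases "snd t d") (auto simp: extended_colors_def)

lemma recolor_colored:
  assumes \<sigma>: "\<sigma> \<in> Bij CK" and t: "t \<in> \<C>"
  shows "recolor \<sigma> t \<in> \<C>"
proof -
  note D = coloredD[OF t]
  have "dom (map_option \<sigma> \<circ> snd t) = dom (snd t)" by (auto simp: dom_def)
  moreover have "ran (map_option \<sigma> \<circ> snd t) \<subseteq> CK"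
    using D(3) \<sigma> by (fastforce simp: ran_def Bij_def bij_betw_def)
  moreover have "(map_option \<sigma> \<circ> snd t) d = (map_option \<sigma> \<circ> snd t) e \<longleftrightarrow> snd t d = snd t e" for d e
    using inj_on_eq_iff[OF map_option_labels(1)[OF \<sigma>] colored_label[OF t] colored_label[OF t]] by simp
  ultimately show ?thesis using D unfolding recolor_def colored_iff by simp
qed

text \<open>Permutations are extensional functions, arbitrary outside \<open>CK\<close>; the law
  rests on the fact that all colors in \<open>t\<close> belong to \<open>CK\<close>.\<close>

lemma recolor_compose:
  assumes "t \<in> \<C>"
  shows "recolor (compose CK \<sigma> \<tau>) t = recolor \<sigma> (recolor \<tau> t)"
proof -
  have "map_option (compose CK \<sigma> \<tau>) (snd t d) = map_option \<sigma> (map_option \<tau> (snd t d))" for d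
    using colored_label[OF assms, of d]
    by (cases "snd t d") (auto simp: extended_colors_def compose_def)
  then show ?thesis by (simp add: recolor_def comp_def)
qed

lemma recolor_id:
  assumes "t \<in> \<C>"
  shows "recolor (\<lambda>c\<in>CK. c) t = t"
proof -
  have "map_option (\<lambda>c\<in>CK. c) (snd t d) = snd t d" for d
    using colored_label[OF assms, of d] by (cases "snd t d") (auto simp: extended_colors_def)
  then show ?thesis by (simp add: recolor_def comp_def)
qed

lemma map_option_compose:
  assumes "C \<subseteq> labels"
  shows "map_option (compose CK \<sigma> \<tau>) ` C = map_option \<sigma> ` map_option \<tau> ` C"
proof -
  have "map_option (compose CK \<sigma> \<tau>) l = map_option \<sigma> (map_option \<tau> l)" if "l \<in> C" for l
    using that assms by (cases l) (auto simp: extended_colors_def compose_def)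
  then show ?thesis unfolding image_image by (rule image_cong[OF refl])
qed

lemma map_option_id:
  assumes "C \<subseteq> labels"
  shows "map_option (\<lambda>c\<in>CK. c) ` C = C"
proof -
  have "map_option (\<lambda>c\<in>CK. c) l = l" if "l \<in> C" for l
    using that assms by (cases l) (auto simp: extended_colors_def)
  then show ?thesis by simp
qed

lemma recolor_flip:
  assumes "colored_flip K z l t t'"
  shows "colored_flip K z (map_option \<sigma> l) (recolor \<sigma> t) (recolor \<sigma> t')"
proof -
  obtain d e where de: "flips_to K (fst t) d e" "snd t d = l" "fst t' = flip_result (fst t) d e"
    "snd t' e = l" "\<forall>x \<in> fst t - sym_orbit z d. snd t' x = snd t x"
    using assms unfolding colored_flip_iff by blast
  then show ?thesis
    unfolding colored_flip_iff by (intro exI[of _ d] exI[of _ e]) (simp add: snd_recolor)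
qed

lemma recolor_equivalent:
  assumes \<sigma>: "\<sigma> \<in> Bij CK" and tt': "(t, t') \<in> equivalent C"
  shows "(recolor \<sigma> t, recolor \<sigma> t') \<in> equivalent (map_option \<sigma> ` C)"
proof -
  have "(t, t') \<in> (flip_rel C)\<^sup>*" using tt' equivalent_iff by blast
  then have "(recolor \<sigma> t, recolor \<sigma> t') \<in> (flip_rel (map_option \<sigma> ` C))\<^sup>*"
  proof (induction rule: rtrancl_induct)
    case (step t' t'')
    then have "(recolor \<sigma> t', recolor \<sigma> t'') \<in> flip_rel (map_option \<sigma> ` C)"
      using recolor_colored[OF \<sigma>] recolor_flip unfolding flip_rel_def by blast
    then show ?case using step.IH by simp
  qed simp
  then show ?thesis using tt' recolor_colored[OF \<sigma>] equivalent_iff by blast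
qed

definition inverse_color :: "('c \<Rightarrow> 'c) \<Rightarrow> 'c \<Rightarrow> 'c" where
  "inverse_color \<sigma> = restrict (inv_into CK \<sigma>) CK"

lemma inverse_color:
  assumes "\<sigma> \<in> Bij CK"
  shows "inverse_color \<sigma> \<in> Bij CK" "compose CK (inverse_color \<sigma>) \<sigma> = (\<lambda>c\<in>CK. c)"
    "compose CK \<sigma> (inverse_color \<sigma>) = (\<lambda>c\<in>CK. c)"
proof -
  have b: "bij_betw \<sigma> CK CK" using assms by (simp add: Bij_def)
  show "inverse_color \<sigma> \<in> Bij CK"
    using restrict_inv_into_Bij[OF assms] by (simp add: inverse_color_def)
  show "compose CK (inverse_color \<sigma>) \<sigma> = (\<lambda>c\<in>CK. c)"
    using Bij_compose_restrict_eq[OF assms] by (simp add: inverse_color_def)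
  show "compose CK \<sigma> (inverse_color \<sigma>) = (\<lambda>c\<in>CK. c)"
    using b by (auto simp: compose_def inverse_color_def fun_eq_iff f_inv_into_f bij_betw_def)
qed

text \<open>Equivalence is preserved by \<open>\<sigma>\<close> and also by its inverse, which gives
  the two inclusions.\<close>

lemma recolor_class:
  assumes \<sigma>: "\<sigma> \<in> Bij CK" and t: "t \<in> \<C>" and C: "C \<subseteq> labels"
  shows "recolor \<sigma> ` (equivalent C `` {t}) = equivalent (map_option \<sigma> ` C) `` {recolor \<sigma> t}"
proof (intro equalityI subsetI)
  fix s assume "s \<in> equivalent (map_option \<sigma> ` C) `` {recolor \<sigma> t}"
  then have s: "(recolor \<sigma> t, s) \<in> equivalent (map_option \<sigma> ` C)" "s \<in> \<C>" using equivalent_iff by blast+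
  note inv = inverse_color[OF \<sigma>]
  have "(recolor (inverse_color \<sigma>) (recolor \<sigma> t), recolor (inverse_color \<sigma>) s)
      \<in> equivalent (map_option (inverse_color \<sigma>) ` map_option \<sigma> ` C)"
    using recolor_equivalent[OF inv(1) s(1)] .
  moreover have "recolor (inverse_color \<sigma>) (recolor \<sigma> t) = t"
    using recolor_compose[OF t, of "inverse_color \<sigma>" \<sigma>] recolor_id[OF t] inv(2) by simp
  moreover have "map_option (inverse_color \<sigma>) ` map_option \<sigma> ` C = C"
    using map_option_compose[OF C, of "inverse_color \<sigma>" \<sigma>] map_option_id[OF C] inv(2) by simp
  moreover have "recolor \<sigma> (recolor (inverse_color \<sigma>) s) = s"
    using recolor_compose[OF s(2), of \<sigma> "inverse_color \<sigma>"] recolor_id[OF s(2)] inv(3) by simp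
  ultimately show "s \<in> recolor \<sigma> ` (equivalent C `` {t})"
    by (intro image_eqI[of _ _ "recolor (inverse_color \<sigma>) s"]) simp_all
qed (use recolor_equivalent[OF \<sigma>] in blast)

text \<open>Both colorings separate exactly the orbits of the same triangulation, so colors can be
  matched along the diagonals. Every color occurs in \<open>t\<close>, and an injection of a finite
  set into itself is bijective.\<close>

lemma same_triangulation_recolor:
  assumes t: "t \<in> \<C>" and s: "s \<in> \<C>" and eq: "fst t = fst s"
  shows "\<exists>\<sigma> \<in> Bij CK. recolor \<sigma> t = s"
proof -
  note T = coloredD[OF t] and S = coloredD[OF s, folded eq]
  \<comment> \<open>Any diagonal of color \<open>c\<close> will do, since the only other candidate
    is its mirror image, which has the same color in \<open>s\<close>.\<close>
  define pick where "pick c = (SOME d. d \<in> fst t \<and> snd t d = Some c)" for c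
  define \<sigma> where "\<sigma> = (\<lambda>c\<in>CK. the (snd s (pick c)))"
  have pick: "pick c \<in> fst t \<and> snd t (pick c) = Some c" if "c \<in> CK" for c
  proof -
    have "Some c \<in> snd t ` fst t" using colored_labels[OF t] that by (simp add: extended_colors_def)
    then have "\<exists>d. d \<in> fst t \<and> snd t d = Some c" by (metis imageE)
    then show ?thesis unfolding pick_def by (rule someI_ex)
  qed
  have dom: "dom (snd t) = dom (snd s)" using T(2) S(2) by simp
  have main: "snd s d = map_option \<sigma> (snd t d)" for d
  proof (cases "snd t d")
    case None
    then have "d \<notin> dom (snd s)" using dom by (metis domIff)
    then show ?thesis using None by (simp add: domIff)
  next
    case (Some c)
    then have "d \<in> dom (snd t)" by blast
    then have d: "d \<in> fst t" using T(2) by simp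
    have c: "c \<in> CK" using Some T(3) ranI[of "snd t" d c] by blast
    note p = pick[OF c]
    have "sym_orbit z (pick c) = sym_orbit z d"
      using T(4)[of "pick c" d] p d Some by simp
    then have "snd s (pick c) = snd s d" using S(4)[of "pick c" d] p d by simp
    moreover have "d \<in> dom (snd s)" using Some dom by (metis domI)
    ultimately show ?thesis using Some c by (auto simp: \<sigma>_def)
  qed
  have im: "\<sigma> c \<in> CK" if "c \<in> CK" for c
  proof -
    have "snd s (pick c) = Some (\<sigma> c)" using main[of "pick c"] pick[OF that] by simp
    then show ?thesis using S(3) ranI[of "snd s"] by blast
  qed
  have "inj_on \<sigma> CK"
  proof (rule inj_onI)
    fix c c' assume c: "c \<in> CK" "c' \<in> CK" "\<sigma> c = \<sigma> c'"
    then have "snd s (pick c) = snd s (pick c')" using main pick by simp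
    then have "snd t (pick c) = snd t (pick c')"
      using S(4)[of "pick c" "pick c'"] T(4)[of "pick c" "pick c'"] pick c by simp
    then show "c = c'" using pick c by simp
  qed
  then have "bij_betw \<sigma> CK CK"
    using endo_inj_surj[OF finite_colors, of \<sigma>] im by (auto simp: bij_betw_def)
  then have "\<sigma> \<in> Bij CK" by (simp add: Bij_def \<sigma>_def)
  moreover have "recolor \<sigma> t = s"
    using main eq by (intro prod_eqI) (simp_all add: recolor_def comp_def fun_eq_iff)
  ultimately show ?thesis by blast
qed

section \<open>The action on faces\<close>

lemma poset_cases:
  assumes "F \<in> \<P>"
  obtains "F = Least" | C t where "F = Face C (equivalent C `` {t})" "C \<subseteq> labels" "t \<in> \<C>"
  using assms unfolding colorful_cyclohedron_def by (auto elim: quotientE)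

lemma face_in_poset: "C \<subseteq> labels \<Longrightarrow> t \<in> \<C> \<Longrightarrow> Face C (equivalent C `` {t}) \<in> \<P>"
  unfolding colorful_cyclohedron_def by (auto intro: quotientI)

lemma least_in_poset: "Least \<in> \<P>"
  by (simp add: colorful_cyclohedron_def)

lemma permute_face_class:
  assumes "\<sigma> \<in> Bij CK" "C \<subseteq> labels" "t \<in> \<C>"
  shows "permute_face \<sigma> (Face C (equivalent C `` {t})) =
    Face (map_option \<sigma> ` C) (equivalent (map_option \<sigma> ` C) `` {recolor \<sigma> t})"
  using recolor_class assms by simp

lemma permute_face_closed:
  assumes \<sigma>: "\<sigma> \<in> Bij CK" and F: "F \<in> \<P>"
  shows "permute_face \<sigma> F \<in> \<P>"
  using F
proof (cases rule: poset_cases)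
  case (2 C t)
  have "map_option \<sigma> ` C \<subseteq> labels" using map_option_labels(2)[OF \<sigma>] 2(2) by blast
  then show ?thesis
    unfolding 2(1) permute_face_class[OF \<sigma> 2(2,3)]
    by (rule face_in_poset[OF _ recolor_colored[OF \<sigma> 2(3)]])
qed (simp add: least_in_poset)

lemma class_subset: "equivalent C `` {t} \<subseteq> \<C>"
  using equivalent_iff by blast

lemma permute_face_compose:
  assumes "F \<in> \<P>"
  shows "permute_face (compose CK \<sigma> \<tau>) F = permute_face \<sigma> (permute_face \<tau> F)"
  using assms
proof (cases rule: poset_cases)
  case (2 C t)
  have "recolor (compose CK \<sigma> \<tau>) s = recolor \<sigma> (recolor \<tau> s)" if "s \<in> equivalent C `` {t}" for s
    using recolor_compose that class_subset by blast
  then have "recolor (compose CK \<sigma> \<tau>) ` (equivalent C `` {t}) = recolor \<sigma> ` recolor \<tau> ` (equivalent C `` {t})"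
    unfolding image_image by (rule image_cong[OF refl])
  then show ?thesis using 2 map_option_compose by simp
qed simp

lemma permute_face_id:
  assumes "F \<in> \<P>"
  shows "permute_face (\<lambda>c\<in>CK. c) F = F"
  using assms
proof (cases rule: poset_cases)
  case (2 C t)
  have "recolor (\<lambda>c\<in>CK. c) s = s" if "s \<in> equivalent C `` {t}" for s
    using recolor_id that class_subset by blast
  then have "recolor (\<lambda>c\<in>CK. c) ` (equivalent C `` {t}) = equivalent C `` {t}"
    by simp
  then show ?thesis using 2 map_option_id by simp
qed simp

lemma permute_face_inverse:
  assumes "\<sigma> \<in> Bij CK" "F \<in> \<P>"
  shows "permute_face (inverse_color \<sigma>) (permute_face \<sigma> F) = F"
    "permute_face \<sigma> (permute_face (inverse_color \<sigma>) F) = F"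
  using permute_face_compose[OF assms(2)] permute_face_id[OF assms(2)] inverse_color[OF assms(1)]
  by metis+

lemma color_action_Bij:
  assumes \<sigma>: "\<sigma> \<in> Bij CK"
  shows "color_action K z CK \<sigma> \<in> Bij \<P>"
proof -
  have "bij_betw (permute_face \<sigma>) \<P> \<P>"
    by (rule bij_betw_byWitness[where f' = "permute_face (inverse_color \<sigma>)"])
      (use permute_face_inverse[OF \<sigma>] permute_face_closed[OF \<sigma>]
        permute_face_closed[OF inverse_color(1)[OF \<sigma>]] in blast)+
  then have "bij_betw (color_action K z CK \<sigma>) \<P> \<P>"
    by (simp add: color_action_def cong: bij_betw_cong)
  then show ?thesis by (simp add: Bij_def color_action_def)
qed

lemma color_group_action: "group_action (BijGroup CK) \<P> (color_action K z CK)"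
proof (intro group_action.intro group_hom.intro group_BijGroup group_hom_axioms.intro homI)
  show "color_action K z CK \<sigma> \<in> carrier (BijGroup \<P>)" if "\<sigma> \<in> carrier (BijGroup CK)" for \<sigma>
    using that color_action_Bij by (simp add: BijGroup_def)
  fix \<sigma> \<tau> assume "\<sigma> \<in> carrier (BijGroup CK)" "\<tau> \<in> carrier (BijGroup CK)"
  then have B: "\<sigma> \<in> Bij CK" "\<tau> \<in> Bij CK" by (simp_all add: BijGroup_def)
  have "color_action K z CK (compose CK \<sigma> \<tau>) F =
      compose \<P> (color_action K z CK \<sigma>) (color_action K z CK \<tau>) F" for F
    using permute_face_compose permute_face_closed[OF B(2)]
    by (simp add: color_action_def compose_def)
  then show "color_action K z CK (\<sigma> \<otimes>\<^bsub>BijGroup CK\<^esub> \<tau>) =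
      color_action K z CK \<sigma> \<otimes>\<^bsub>BijGroup \<P>\<^esub> color_action K z CK \<tau>"
    using B color_action_Bij by (simp add: BijGroup_def fun_eq_iff)
qed

lemma cface_le_permute_mono: "cface_le F F' \<Longrightarrow> cface_le (permute_face \<sigma> F) (permute_face \<sigma> F')"
  by (cases F; cases F') auto

lemma cface_le_permute:
  assumes \<sigma>: "\<sigma> \<in> Bij CK" and F: "F \<in> \<P>" "F' \<in> \<P>"
  shows "cface_le (permute_face \<sigma> F) (permute_face \<sigma> F') \<longleftrightarrow> cface_le F F'"
  using cface_le_permute_mono[of F F' \<sigma>] permute_face_inverse(1)[OF \<sigma>] F
    cface_le_permute_mono[of "permute_face \<sigma> F" "permute_face \<sigma> F'" "inverse_color \<sigma>"] by metis

section \<open>Comparison with the faces of the ordinary cyclohedron\<close>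

fun uncolored_vertices :: "'c cface \<Rightarrow> point set set set" where
  "uncolored_vertices Least = {}"
| "uncolored_vertices (Face C X) = fst ` X"

lemma uncolored_vertices_permute [simp]:
  "uncolored_vertices (permute_face \<sigma> F) = uncolored_vertices F"
  by (cases F) (simp_all add: image_image)

lemma uncolored_vertices_mono: "cface_le F F' \<Longrightarrow> uncolored_vertices F \<subseteq> uncolored_vertices F'"
  by (cases F; cases F') auto

text \<open>This contains both reflection of the order and injectivity on orbits. A triangulation
  common to the two vertex sets has a coloring in each face; the permutation relating these
  colorings turns both faces into classes of the same \<open>t\<close>, which are compared by their
  label sets.\<close>

lemma uncolored_vertices_subset:
  assumes F: "F \<in> \<P>" "F' \<in> \<P>" and sub: "uncolored_vertices F \<subseteq> uncolored_vertices F'"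
  shows "\<exists>\<sigma>\<in>Bij CK. cface_le F (permute_face \<sigma> F') \<and>
    (uncolored_vertices F = uncolored_vertices F' \<longrightarrow> F = permute_face \<sigma> F')"
  using F(1)
proof (cases rule: poset_cases)
  case 1
  have "uncolored_vertices F' = {} \<longrightarrow> F' = Least"
    using F(2)
  proof (cases rule: poset_cases)
    case (2 C t)
    then have "t \<in> equivalent C `` {t}" by (simp add: equivalent_iff)
    then show ?thesis using 2(1) by auto
  qed simp
  then show ?thesis using 1 id_Bij[of CK] by (intro bexI[of _ "\<lambda>c\<in>CK. c"]) auto
next
  case (2 C t)
  have "t \<in> equivalent C `` {t}" using 2(3) by (simp add: equivalent_iff)
  then have tF: "fst t \<in> uncolored_vertices F" using 2(1) by simp
  from F(2) show ?thesis
  proof (cases rule: poset_cases)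
    case 1
    then show ?thesis using sub tF by auto
  next
    case F': (2 C' t')
    have "fst t \<in> fst ` (equivalent C' `` {t'})" using sub tF F'(1) by auto
    then obtain s where s: "(t', s) \<in> equivalent C'" "fst s = fst t" by auto
    then have sC: "s \<in> \<C>" using equivalent_iff by blast
    have cls: "equivalent C' `` {t'} = equivalent C' `` {s}"
      using equiv_class_eq[OF equiv_equivalent s(1)] .
    obtain \<sigma> where \<sigma>: "\<sigma> \<in> Bij CK" "recolor \<sigma> s = t"
      using same_triangulation_recolor[OF sC 2(3)] s(2) by blast
    define C2 where "C2 = map_option \<sigma> ` C'"
    have perm: "permute_face \<sigma> F' = Face C2 (equivalent C2 `` {t})"
      unfolding F'(1) cls C2_def permute_face_class[OF \<sigma>(1) F'(2) sC] \<sigma>(2) ..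
    have v: "uncolored_vertices F = star (fixed C t)" using 2 fst_image_class by simp
    have v': "uncolored_vertices F' = star (fixed C2 t)"
      using uncolored_vertices_permute[of \<sigma> F'] fst_image_class[OF 2(3)] by (simp add: perm)
    have C2: "C2 \<subseteq> labels" using F'(2) map_option_labels(2)[OF \<sigma>(1)] unfolding C2_def by blast
    \<comment> \<open>Every label occurs in \<open>t\<close>, so fewer fixed diagonals mean more
      labels.\<close>
    have le: "A \<subseteq> B" if "A \<subseteq> labels" "fixed B t \<subseteq> fixed A t" for A B
    proof
      fix l assume l: "l \<in> A"
      then have "l \<in> snd t ` fst t" using that(1) colored_labels[OF 2(3)] by blast
      then obtain d where d: "d \<in> fst t" "snd t d = l" by blast
      then have "d \<notin> fixed A t" using l by (simp add: fixed_def)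
      then show "l \<in> B" using that(2) d by (auto simp: fixed_def)
    qed
    have "C \<subseteq> C2"
      using le[OF 2(2)] star_subset[OF 2(3)] sub v v' by simp
    moreover have "equivalent C `` {t} \<subseteq> equivalent C2 `` {t}"
    proof -
      have "flip_rel C \<subseteq> flip_rel C2" using \<open>C \<subseteq> C2\<close> by (auto simp: flip_rel_def)
      then have "(flip_rel C)\<^sup>* \<subseteq> (flip_rel C2)\<^sup>*" by (rule rtrancl_mono)
      then show ?thesis using equivalent_iff by blast
    qed
    moreover have "C2 = C" if "uncolored_vertices F = uncolored_vertices F'"
      using le[OF C2, of C] star_subset[OF 2(3), of C2 "fixed C t"] that v v' \<open>C \<subseteq> C2\<close> by auto
    ultimately show ?thesis
      using \<sigma>(1) perm 2(1) by (intro bexI[of _ \<sigma>]) auto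
  qed
qed

text \<open>Labels are constant on orbits, so the fixed diagonals form a union of whole
  orbits.\<close>

lemma uncolored_vertices_face:
  assumes F: "F \<in> \<P>"
  shows "uncolored_vertices F \<in> cyclohedron_face_lattice n K z"
  using F
proof (cases rule: poset_cases)
  case 1
  then show ?thesis by (simp add: cyclohedron_face_lattice_def)
next
  case (2 C t)
  note T = coloredD[OF 2(3)]
  let ?D = "fixed C t"
  let ?O = "sym_orbit z ` ?D"
  have DT: "?D \<subseteq> fst t" by (auto simp: fixed_def)
  have "\<Union> ?O \<subseteq> ?D"
  proof
    fix x assume "x \<in> \<Union> ?O"
    then obtain d where d: "d \<in> ?D" "x \<in> sym_orbit z d" by blast
    then have "x \<in> fst t" using cs_sym_orbit[OF T(1)] DT by blast
    moreover have "snd t x = snd t d" using T(4)[of x d] d DT \<open>x \<in> fst t\<close> by (auto simp: mem_sym_orbit)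
    ultimately show "x \<in> ?D" using d(1) by (simp add: fixed_def)
  qed
  moreover have "?D \<subseteq> \<Union> ?O" by (auto simp: sym_orbit_mirrored)
  ultimately have U: "\<Union> ?O = ?D" by (rule subset_antisym)
  have fin: "finite (sym_orbit z ` fst t)"
    using triangulation_finite[OF cs_triangulation[OF T(1)]] by simp
  have "card ?O \<le> card (sym_orbit z ` fst t)"
    by (rule card_mono[OF fin image_mono[OF DT]])
  then have "card ?O \<le> n + 1" using cs_card_orbits[OF T(1)] by simp
  \<comment> \<open>The bound by \<open>n + 1\<close> is what lets the truncated subtractions
    cancel.\<close>
  then have "card ?O = n + 1 - (n + 1 - card ?O)" by simp
  moreover have "?O \<subseteq> sym_orbit z ` diagonals K"
    using DT cs_diagonal[OF T(1)] by blast
  moreover have "noncrossing ?D"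
    unfolding noncrossing_def
    using DT triangulation_not_crossing[OF cs_triangulation[OF T(1)]] by (meson subsetD)
  ultimately have "star ?D \<in> cyclohedron_faces n K z (n + 1 - card ?O)"
    unfolding cyclohedron_faces_def star_def mem_Collect_eq by (intro exI[of _ ?O]) (simp add: U)
  moreover have "n + 1 - card ?O \<in> {0..n + 1}" by simp
  moreover have "uncolored_vertices F = star ?D" using 2 fst_image_class by simp
  ultimately show ?thesis
    unfolding cyclohedron_face_lattice_def by (intro insertI2 UN_I) simp_all
qed

text \<open>A nonempty face is the star of a union \<open>D\<close> of orbits. Extend
  \<open>D\<close> to a symmetric triangulation \<open>T\<close>, color it arbitrarily and let
  \<open>C\<close> consist of the labels on \<open>T - D\<close>; since \<open>D\<close> contains
  whole orbits, no label on \<open>D\<close> gets into \<open>C\<close>.\<close>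

lemma face_uncolored_vertices:
  assumes "A \<in> cyclohedron_face_lattice n K z"
  shows "\<exists>F\<in>\<P>. uncolored_vertices F = A"
proof (cases "A = {}")
  case True
  then show ?thesis using least_in_poset by (intro bexI[of _ Least]) auto
next
  case False
  then obtain \<O> where \<O>: "A = {T \<in> cs. \<Union>\<O> \<subseteq> T}" "\<O> \<subseteq> sym_orbit z ` diagonals K" "noncrossing (\<Union>\<O>)"
    using assms unfolding cyclohedron_face_lattice_def cyclohedron_faces_def by blast
  define D where "D = \<Union>\<O>"
  have orb: "sym_orbit z d \<subseteq> D" if dD: "d \<in> D" for d
  proof -
    obtain P where P: "d \<in> P" "P \<in> \<O>" using dD unfolding D_def by (rule UnionE)
    then obtain e where "P = sym_orbit z e" using \<O>(2) by blast
    then have "d \<in> sym_orbit z e" "sym_orbit z e \<in> \<O>" using P by simp_all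
    then show ?thesis unfolding mem_sym_orbit D_def by (simp add: Union_upper)
  qed
  have "D \<subseteq> diagonals K"
    using \<O>(2) mirrored_diagonal by (auto simp: D_def sym_orbit_mirrored)
  then obtain T where T: "T \<in> cs" "D \<subseteq> T"
    using cs_extension[of D] \<O>(3) orb by (auto simp: D_def sym_orbit_mirrored)
  obtain \<kappa> where \<kappa>: "(T, \<kappa>) \<in> \<C>" using coloring_exists[OF T(1)] by blast
  define C where "C = \<kappa> ` (T - D)"
  have "C \<subseteq> labels" using colored_labels[OF \<kappa>] by (auto simp: C_def)
  have "fixed C (T, \<kappa>) = D"
  proof (intro equalityI subsetI)
    fix d assume d: "d \<in> D"
    have "\<kappa> d \<noteq> \<kappa> e" if "e \<in> T - D" for e
      using that d T(2) coloredD(4)[OF \<kappa>, of d e] orb[OF d] mem_sym_orbit[of e d] by auto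
    then show "d \<in> fixed C (T, \<kappa>)" using d T(2) by (auto simp: fixed_def C_def)
  qed (auto simp: fixed_def C_def)
  then have "uncolored_vertices (Face C (equivalent C `` {(T, \<kappa>)})) = A"
    using fst_image_class[OF \<kappa>] \<O>(1) by (simp add: star_def D_def)
  then show ?thesis using face_in_poset[OF \<open>C \<subseteq> labels\<close> \<kappa>] by blast
qed

lemma quotient_isomorphic:
  "poset_isomorphic (quotient_poset K z CK) quotient_le (cyclohedron_face_lattice n K z) (\<subseteq>)"
proof -
  interpret group_action "BijGroup CK" \<P> "color_action K z CK" by (rule color_group_action)
  define orb where "orb = orbit (BijGroup CK) (color_action K z CK)"
  \<comment> \<open>All faces in an orbit have the same vertex set, so the union equals this set and
    no representative has to be chosen.\<close>
  define f where "f P = (\<Union>F\<in>P. uncolored_vertices F)" for P :: "'c cface set"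
  have Q: "quotient_poset K z CK = orb ` \<P>"
    by (auto simp: quotient_poset_def orbits_def orb_def)
  have orb: "orb F = {permute_face \<sigma> F | \<sigma>. \<sigma> \<in> Bij CK}" if "F \<in> \<P>" for F
    using that by (simp add: orb_def orbit_def color_action_def BijGroup_def)
  have mem: "F \<in> orb F" if "F \<in> \<P>" for F using orbit_refl[OF that] by (simp add: orb_def)
  have f: "f (orb F) = uncolored_vertices F" if "F \<in> \<P>" for F
    using mem[OF that] by (auto simp: f_def orb[OF that])
  have le: "quotient_le (orb F) (orb F') \<longleftrightarrow> uncolored_vertices F \<subseteq> uncolored_vertices F'"
    if F: "F \<in> \<P>" "F' \<in> \<P>" for F F'
  proof
    assume "quotient_le (orb F) (orb F')"
    then show "uncolored_vertices F \<subseteq> uncolored_vertices F'"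
      using uncolored_vertices_mono by (fastforce simp: quotient_le_def orb F)
  next
    assume "uncolored_vertices F \<subseteq> uncolored_vertices F'"
    then obtain \<sigma> where "\<sigma> \<in> Bij CK" "cface_le F (permute_face \<sigma> F')"
      using uncolored_vertices_subset[OF F] by blast
    then show "quotient_le (orb F) (orb F')"
      using mem[OF F(1)] orb[OF F(2)] unfolding quotient_le_def by blast
  qed
  have inj: "orb F = orb F'" if F: "F \<in> \<P>" "F' \<in> \<P>" and eq: "uncolored_vertices F = uncolored_vertices F'" for F F'
  proof -
    obtain \<sigma> where "\<sigma> \<in> Bij CK" "F = permute_face \<sigma> F'"
      using uncolored_vertices_subset[OF F] eq by blast
    then have FF': "F \<in> orb F'" using orb[OF F(2)] by blast
    then have F'F: "F' \<in> orb F" using orbit_sym[OF F(2,1)] by (simp add: orb_def)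
    have sub: "orb A \<subseteq> orb B" if "A \<in> \<P>" "B \<in> \<P>" "A \<in> orb B" for A B
    proof
      fix G assume G: "G \<in> orb A"
      then have "G \<in> \<P>" using orb[OF that(1)] permute_face_closed that(1) by auto
      then show "G \<in> orb B" using orbit_trans[OF that(2,1)] that(3) G by (simp add: orb_def)
    qed
    show ?thesis using sub[OF F FF'] sub[OF F(2,1) F'F] by (rule subset_antisym)
  qed
  have "bij_betw f (quotient_poset K z CK) (cyclohedron_face_lattice n K z)"
  proof (rule bij_betw_imageI)
    show "inj_on f (quotient_poset K z CK)"
    proof (rule inj_onI)
      fix P P' assume P: "P \<in> quotient_poset K z CK" "P' \<in> quotient_poset K z CK" "f P = f P'"
      obtain F where F: "P = orb F" "F \<in> \<P>" using P(1)[unfolded Q] by (rule imageE)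
      obtain F' where F': "P' = orb F'" "F' \<in> \<P>" using P(2)[unfolded Q] by (rule imageE)
      have "uncolored_vertices F = uncolored_vertices F'" using P(3) F F' f by simp
      then show "P = P'" using inj[OF F(2) F'(2)] F(1) F'(1) by simp
    qed
    show "f ` quotient_poset K z CK = cyclohedron_face_lattice n K z"
    proof (intro equalityI subsetI)
      fix A assume "A \<in> cyclohedron_face_lattice n K z"
      then obtain F where "F \<in> \<P>" "uncolored_vertices F = A" using face_uncolored_vertices by blast
      then show "A \<in> f ` quotient_poset K z CK" unfolding Q using f by force
    qed (use f uncolored_vertices_face in \<open>auto simp: Q\<close>)
  qed
  moreover have "\<forall>P\<in>quotient_poset K z CK. \<forall>P'\<in>quotient_poset K z CK. quotient_le P P' \<longleftrightarrow> f P \<subseteq> f P'"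
    unfolding Q using le f by auto
  ultimately show ?thesis unfolding poset_isomorphic_def by blast
qed

end

theorem theorem14:
  fixes n :: nat and K :: "(real ^ 2) set" and z :: "real ^ 2" and CK :: "'c set"
  assumes "convex_polygon (2 * n + 4) K"
    and "centrally_symmetric z K"
    and "finite CK" and "card CK = n"
  shows "group_action (BijGroup CK) (colorful_cyclohedron K z CK) (color_action K z CK)
    \<and> (\<forall>\<sigma>\<in>carrier (BijGroup CK).
         \<forall>F\<in>colorful_cyclohedron K z CK. \<forall>F'\<in>colorful_cyclohedron K z CK.
           cface_le (color_action K z CK \<sigma> F) (color_action K z CK \<sigma> F') \<longleftrightarrow> cface_le F F')
    \<and> poset_isomorphic (quotient_poset K z CK) quotient_le
        (cyclohedron_face_lattice n K z) (\<subseteq>)"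
proof -
  interpret colored_polygon n K z CK
    using assms by unfold_locales
  show ?thesis
  proof (intro conjI ballI color_group_action quotient_isomorphic)
    fix \<sigma> F F'
    assume "\<sigma> \<in> carrier (BijGroup CK)" "F \<in> colorful_cyclohedron K z CK" "F' \<in> colorful_cyclohedron K z CK"
    then show "cface_le (color_action K z CK \<sigma> F) (color_action K z CK \<sigma> F') \<longleftrightarrow> cface_le F F'"
      using cface_le_permute[of \<sigma> F F'] by (simp add: color_action_def BijGroup_def)
  qed
qed

end
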